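(* Let $V$ be a finite-dimensional complex vector space. Let $\lambda,\mu$ be partitions such that $\mu$ is obtained from $\lambda$ by appending a single box, and let $k$ be the index of the column containing this box. Let $\zeta_\lambda^\mu$ be the linear map defined in the context, regarded as a map $V\otimes \mathbf{X}^{\lambda^*}V\simeq \mathbf{X}^{(\lambda^*,1)}V\to \mathbf{X}^{\mu^*}V$. Then $$\zeta_\lambda^\mu(V\otimes \mathcal{I}^\lambda)\subseteq \mathcal{I}^\mu .$$ Hence the map $\varphi_{\lambda,\mu}: V\otimes \mathbf{S}^\lambda V\to \mathbf{S}^\mu V$ induced by $\zeta_\lambda^\mu$ on the quotients $\mathbf{S}^\lambda V=\mathbf{X}^{\lambda^*}V/\mathcal{I}^\lambda$ and $\mathbf{S}^\mu V=\mathbf{X}^{\mu^*}V/\mathcal{I}^\mu$ is well-defined.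
   Context: Partitions are identified with their Young diagrams; $|\lambda|$ is the number of boxes, $\lambda_1$ the number of columns, and $\lambda^*$ the transposed partition, so $\lambda^*_i$ is the length of the $i$-th column ($\lambda^*_i=0$ for $i>\lambda_1$). Columns and $Y_d$. For a composition $\alpha$ of $d$ (a tuple of nonnegative integers summing to $d$, regarded as a $d$-tuple $(\alpha_1,\dots,\alpha_d)$ by padding with zeros) let $\mathbf{X}^\alpha V=\bigwedge^{\alpha_1}V\otimes\cdots\otimes\bigwedge^{\alpha_d}V$, and let $Y_d=\bigoplus_\alpha \mathbf{X}^\alpha V$ (outer direct sum over all such $\alpha$). There is a natural isomorphism $Y_d\simeq\bigwedge^d(V^{\oplus d})$: if $x_{a,j}$ denotes the basis vector $x_a$ of $V$ placed in the $j$-th copy of $V$ in $V^{\oplus d}$, then a tensor product of wedge products is sent to the wedge product, in the same order, where factors from the $j$-th column are replaced by their copies in the $j$-th summand (e.g. $x_1\wedge x_3\otimes x_2\wedge x_4\mapsto x_{1,1}\wedge x_{3,1}\wedge x_{2,2}\wedge x_{4,2}$). The group $\mathrm{GL}(V)$ acts diagonally on $V^{\oplus d}$. The maps $\sigma_{i,j}$. For $i\ne j$ in $\{1,\dots,d\}$ let $\sigma_{i,j}:Y_d\to Y_d$ be the derivation of $\bigwedge^d(V^{\oplus d})$ (Lie algebra action) induced by the endomorphism of $V^{\oplus d}$ that sends the $i$-th copy of $V$ identically onto the $j$-th copy and all other copies to $0$. So $\sigma_{i,j}$ moves one box from column $i$ to column $j$, summed over all boxes of column $i$, and $\sigma_{i,j}$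 vanishes on $\mathbf{X}^\alpha V$ if $\alpha_i=0$. The subspace $\mathcal{I}^\lambda$. With $e_i$ the $i$-th unit vector, $\mathcal{I}^\lambda\subseteq \mathbf{X}^{\lambda^*}V$ is the linear span of the subspaces $\sigma_{i,i+1}(\mathbf{X}^{\lambda^*+e_i-e_{i+1}}V)$ over all $i\ge 1$ with $\lambda^*_{i+1}>0$. The Schur module is $\mathbf{S}^\lambda V=\mathbf{X}^{\lambda^*}V/\mathcal{I}^\lambda$. The map $\zeta_\lambda^\mu$. Let $d=|\lambda|+1$. Let $(\lambda^*,1)=(\lambda^*_1,\dots,\lambda^*_{\lambda_1},1)$; one identifies $V\otimes\mathbf{X}^{\lambda^*}V$ with $\mathbf{X}^{(\lambda^*,1)}V$ by placing the factor $V$ in column $\lambda_1+1$. Let $\mathcal{A}^m_k$ be the set of all strictly decreasing sequences $J=(J_1,\dots,J_p)$ of positive integers, $p\ge 1$, with $J_1=m$ and $J_p=k$. Put $\sigma_J=\sigma_{J_1,J_2}\circ\sigma_{J_2,J_3}\circ\cdots\circ\sigma_{J_{p-1},J_p}$ (the identity if $p=1$), and $D_J(\lambda^* )=\prod_{q=2}^{p-1}(\lambda^*_k-\lambda^*_{J_q}+J_q-k+1)$ (empty products are $1$). Define $$\zeta_\lambda^\mu=\sum_{J\in\mathcal{A}^{\lambda_1+1}_k}\frac{\sigma_J}{D_J(\lambda^* )}:Y_d\to Y_d .$$ It maps $\mathbf{X}^{(\lambda^*,1)}V$ into $\mathbf{X}^{\mu^*}V$. *)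

theory Defs
  imports Complex_Main "HOL-Library.Poly_Mapping" "HOL-Library.FuncSet"
begin

section \<open>Complex vector spaces\<close>

class complex_vector = ab_group_add +
  fixes scaleC :: "complex \<Rightarrow> 'a \<Rightarrow> 'a"  (infixr \<open>*\<^sub>C\<close> 75)
  assumes scaleC_add_right: "a *\<^sub>C (x + y) = a *\<^sub>C x + a *\<^sub>C y"
    and scaleC_add_left: "(a + b) *\<^sub>C x = a *\<^sub>C x + b *\<^sub>C x"
    and scaleC_scaleC: "a *\<^sub>C (b *\<^sub>C x) = (a * b) *\<^sub>C x"
    and scaleC_one: "1 *\<^sub>C x = x"

global_interpretation complex_vector:
  vector_space "scaleC :: complex \<Rightarrow> 'a \<Rightarrow> 'a :: complex_vector"
  by unfold_locales (simp_all add: scaleC_add_right scaleC_add_left scaleC_scaleC scaleC_one)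

abbreviation cspan :: "'a::complex_vector set \<Rightarrow> 'a set"
  where "cspan \<equiv> complex_vector.span"

abbreviation clinear :: "('a::complex_vector \<Rightarrow> 'b::complex_vector) \<Rightarrow> bool"
  where "clinear \<equiv> Vector_Spaces.linear scaleC scaleC"

lemma clinearI:
  assumes "\<And>x y. f (x + y) = f x + f y" and "\<And>c x. f (c *\<^sub>C x) = c *\<^sub>C f x"
  shows "clinear f"
  by unfold_locales (use assms in \<open>simp_all add: scaleC_add_right scaleC_add_left scaleC_scaleC scaleC_one\<close>)

lemma clinear_add: "clinear f \<Longrightarrow> f (x + y) = f x + f y"
  by (rule module_hom.add[OF Vector_Spaces.linear.axioms(3)])

lemma clinear_scaleC: "clinear f \<Longrightarrow> f (c *\<^sub>C x) = c *\<^sub>C f x"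
  by (rule module_hom.scale[OF Vector_Spaces.linear.axioms(3)])

lemma clinear_diff: "clinear f \<Longrightarrow> f (x - y) = f x - f y"
  by (rule module_hom.diff[OF Vector_Spaces.linear.axioms(3)])

lemma clinear_image_span:
  assumes "clinear f" and "\<And>x. x \<in> A \<Longrightarrow> f x \<in> cspan B" and "x \<in> cspan A"
  shows "f x \<in> cspan B"
  using assms(3)
proof (induction x rule: complex_vector.span_induct_alt)
  case base
  from clinear_diff[OF assms(1), of 0 0] show ?case
    by (simp add: complex_vector.span_zero)
next
  case (step c x y)
  then show ?case
    by (simp add: clinear_add[OF assms(1)] clinear_scaleC[OF assms(1)] assms(2)
        complex_vector.span_add complex_vector.span_scale)
qed

instantiation complex :: complex_vector
begin
definition scaleC_complex :: "complex \<Rightarrow> complex \<Rightarrow> complex"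
  where "scaleC_complex = (*)"
instance
  by standard (simp_all add: scaleC_complex_def algebra_simps)
end

text \<open>
  This instance makes \<open>'i \<Rightarrow>\<^sub>0 'v\<close> the direct sum of copies of \<open>'v\<close> indexed by \<open>'i\<close>, and
  \<open>'i \<Rightarrow>\<^sub>0 complex\<close> the free vector space with basis \<open>single i 1\<close>.
\<close>

instantiation poly_mapping :: (type, complex_vector) complex_vector
begin
definition scaleC_poly_mapping :: "complex \<Rightarrow> ('a \<Rightarrow>\<^sub>0 'b) \<Rightarrow> ('a \<Rightarrow>\<^sub>0 'b)"
  where "scaleC_poly_mapping c = Poly_Mapping.map (scaleC c)"

lemma lookup_scaleC [simp]:
  "Poly_Mapping.lookup (c *\<^sub>C p) i = c *\<^sub>C Poly_Mapping.lookup (p :: 'a \<Rightarrow>\<^sub>0 'b) i"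
  by (simp add: scaleC_poly_mapping_def Poly_Mapping.map.rep_eq when_def)

instance
  by standard
    (simp_all add: poly_mapping_eq_iff fun_eq_iff lookup_add
      scaleC_add_right scaleC_add_left scaleC_scaleC scaleC_one)
end

abbreviation basis_elt :: "'i \<Rightarrow> ('i \<Rightarrow>\<^sub>0 complex)"
  where "basis_elt i \<equiv> Poly_Mapping.single i 1"

text \<open>The linear extension of a map given on the basis of a free vector space.\<close>

definition free_lin :: "('i \<Rightarrow> 'b::complex_vector) \<Rightarrow> ('i \<Rightarrow>\<^sub>0 complex) \<Rightarrow> 'b"
  where "free_lin f p = (\<Sum>i\<in>Poly_Mapping.keys p. Poly_Mapping.lookup p i *\<^sub>C f i)"

lemma free_lin_superset:
  assumes "finite A" and "Poly_Mapping.keys p \<subseteq> A"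
  shows "free_lin f p = (\<Sum>i\<in>A. Poly_Mapping.lookup p i *\<^sub>C f i)"
  unfolding free_lin_def
  by (rule sum.mono_neutral_left) (use assms in \<open>auto simp: in_keys_iff\<close>)

lemma clinear_free_lin: "clinear (free_lin f)"
proof (rule clinearI)
  fix p q :: "'a \<Rightarrow>\<^sub>0 complex"
  let ?A = "Poly_Mapping.keys p \<union> Poly_Mapping.keys q"
  have "Poly_Mapping.keys (p + q) \<subseteq> ?A"
    by (rule Poly_Mapping.keys_add)
  then show "free_lin f (p + q) = free_lin f p + free_lin f q"
    by (simp add: free_lin_superset[of ?A] lookup_add scaleC_add_left sum.distrib)
next
  fix c and p :: "'a \<Rightarrow>\<^sub>0 complex"
  have "Poly_Mapping.keys (c *\<^sub>C p) \<subseteq> Poly_Mapping.keys p"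
    by (auto simp: in_keys_iff)
  then show "free_lin f (c *\<^sub>C p) = c *\<^sub>C free_lin f p"
    by (simp add: free_lin_superset[of "Poly_Mapping.keys p"] scaleC_complex_def scaleC_scaleC
        complex_vector.scale_sum_right)
qed

lemma free_lin_basis_elt [simp]: "free_lin f (basis_elt i) = f i"
  by (simp add: free_lin_def scaleC_one)


section \<open>Exterior algebras\<close>

text \<open>
  The free vector space on lists of vectors, with concatenation as product, is the free
  associative algebra on the set of vectors. Dividing by multilinearity gives the tensor algebra,
  and dividing by the words with two equal neighbours gives the exterior algebra.
\<close>

definition multilinear_rels :: "('w::complex_vector list \<Rightarrow>\<^sub>0 complex) set" where
  "multilinear_rels =
     {basis_elt (xs @ [u + w] @ ys) - basis_elt (xs @ [u] @ ys) - basis_elt (xs @ [w] @ ys)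
       | xs ys u w. True} \<union>
     {basis_elt (xs @ [c *\<^sub>C u] @ ys) - c *\<^sub>C basis_elt (xs @ [u] @ ys) | xs ys c u. True}"

definition alternating_rels :: "('w::complex_vector list \<Rightarrow>\<^sub>0 complex) set" where
  "alternating_rels = {basis_elt (xs @ [w, w] @ ys) | xs ys w. True}"

definition ext_rels :: "('w::complex_vector list \<Rightarrow>\<^sub>0 complex) set" where
  "ext_rels = cspan (multilinear_rels \<union> alternating_rels)"

definition ext_eq :: "('w::complex_vector list \<Rightarrow>\<^sub>0 complex) \<Rightarrow> ('w list \<Rightarrow>\<^sub>0 complex) \<Rightarrow> bool"
  where "ext_eq p q \<longleftrightarrow> p - q \<in> ext_rels"

lemma ext_rels_add: "p \<in> ext_rels \<Longrightarrow> q \<in> ext_rels \<Longrightarrow> p + q \<in> ext_rels"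
  and ext_rels_diff: "p \<in> ext_rels \<Longrightarrow> q \<in> ext_rels \<Longrightarrow> p - q \<in> ext_rels"
  and ext_rels_neg: "p \<in> ext_rels \<Longrightarrow> - p \<in> ext_rels"
  and ext_rels_scaleC: "p \<in> ext_rels \<Longrightarrow> c *\<^sub>C p \<in> ext_rels"
  and ext_rels_zero: "0 \<in> ext_rels"
  and ext_rels_sum: "(\<And>i. i \<in> A \<Longrightarrow> g i \<in> ext_rels) \<Longrightarrow> sum g A \<in> ext_rels"
  by (simp_all add: ext_rels_def complex_vector.span_add complex_vector.span_diff
      complex_vector.span_neg complex_vector.span_scale complex_vector.span_zero
      complex_vector.span_sum)

lemma ext_rels_plus:
  "basis_elt (xs @ (u + w) # ys) - basis_elt (xs @ u # ys) - basis_elt (xs @ w # ys) \<in> ext_rels"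
  unfolding ext_rels_def multilinear_rels_def by (rule complex_vector.span_base) force

lemma ext_rels_scale:
  "basis_elt (xs @ (c *\<^sub>C u) # ys) - c *\<^sub>C basis_elt (xs @ u # ys) \<in> ext_rels"
  unfolding ext_rels_def multilinear_rels_def by (rule complex_vector.span_base) force

lemma ext_rels_alt: "basis_elt (xs @ w # w # ys) \<in> ext_rels"
  unfolding ext_rels_def alternating_rels_def by (rule complex_vector.span_base) force

lemma equivp_ext_eq: "equivp (ext_eq :: ('w::complex_vector list \<Rightarrow>\<^sub>0 complex) \<Rightarrow> _)"
proof (rule equivpI)
  show "reflp (ext_eq :: ('w list \<Rightarrow>\<^sub>0 complex) \<Rightarrow> _)"
    by (simp add: reflp_def ext_eq_def ext_rels_zero)
  show "symp (ext_eq :: ('w list \<Rightarrow>\<^sub>0 complex) \<Rightarrow> _)"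
  proof (rule sympI)
    fix p q :: "'w list \<Rightarrow>\<^sub>0 complex"
    assume "ext_eq p q"
    then have "- (p - q) \<in> ext_rels"
      unfolding ext_eq_def by (rule ext_rels_neg)
    then show "ext_eq q p"
      by (simp add: ext_eq_def)
  qed
  show "transp (ext_eq :: ('w list \<Rightarrow>\<^sub>0 complex) \<Rightarrow> _)"
  proof (rule transpI)
    fix p q r :: "'w list \<Rightarrow>\<^sub>0 complex"
    assume "ext_eq p q" and "ext_eq q r"
    then have "(p - q) + (q - r) \<in> ext_rels"
      unfolding ext_eq_def by (rule ext_rels_add)
    then show "ext_eq p r"
      by (simp add: ext_eq_def)
  qed
qed

quotient_type (overloaded) 'w ext = "'w::complex_vector list \<Rightarrow>\<^sub>0 complex" / ext_eq
  by (rule equivp_ext_eq)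

instantiation ext :: (complex_vector) complex_vector
begin

lift_definition zero_ext :: "'a ext" is 0 .

lift_definition plus_ext :: "'a ext \<Rightarrow> 'a ext \<Rightarrow> 'a ext" is "(+)"
  unfolding ext_eq_def by (drule (1) ext_rels_add) (simp add: algebra_simps)

lift_definition uminus_ext :: "'a ext \<Rightarrow> 'a ext" is uminus
  unfolding ext_eq_def by (drule ext_rels_neg) (simp add: algebra_simps)

lift_definition minus_ext :: "'a ext \<Rightarrow> 'a ext \<Rightarrow> 'a ext" is "(-)"
  unfolding ext_eq_def by (drule (1) ext_rels_diff) (simp add: algebra_simps)

lift_definition scaleC_ext :: "complex \<Rightarrow> 'a ext \<Rightarrow> 'a ext" is scaleC
  unfolding ext_eq_def by (metis complex_vector.scale_right_diff_distrib ext_rels_scaleC)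

instance
  by standard (transfer; simp add: ext_eq_def ext_rels_zero scaleC_add_right scaleC_add_left
      scaleC_scaleC scaleC_one)+

end

text \<open>The product \<open>w\<^sub>1 \<and> \<dots> \<and> w\<^sub>n\<close> of the vectors in a list.\<close>

lift_definition wedge :: "'w::complex_vector list \<Rightarrow> 'w ext" is basis_elt .

lemma ext_rels_respect:
  assumes "clinear F"
    and "\<And>xs ys u w. F (basis_elt (xs @ (u + w) # ys)) - F (basis_elt (xs @ u # ys))
           - F (basis_elt (xs @ w # ys)) \<in> ext_rels"
    and "\<And>xs ys c u. F (basis_elt (xs @ (c *\<^sub>C u) # ys)) - c *\<^sub>C F (basis_elt (xs @ u # ys))
           \<in> ext_rels"
    and "\<And>xs ys w. F (basis_elt (xs @ w # w # ys)) \<in> ext_rels"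
    and "ext_eq p q"
  shows "ext_eq (F p) (F q)"
proof -
  have "F (p - q) \<in> ext_rels"
    unfolding ext_rels_def
  proof (rule clinear_image_span[OF assms(1)])
    show "p - q \<in> cspan (multilinear_rels \<union> alternating_rels)"
      using assms(5) by (simp add: ext_eq_def ext_rels_def)
    fix r :: "'a list \<Rightarrow>\<^sub>0 complex"
    assume "r \<in> multilinear_rels \<union> alternating_rels"
    then have "F r \<in> ext_rels"
      by (auto simp: multilinear_rels_def alternating_rels_def clinear_diff[OF assms(1)]
          clinear_scaleC[OF assms(1)] assms(2-4))
    then show "F r \<in> cspan (multilinear_rels \<union> alternating_rels)"
      by (simp add: ext_rels_def)
  qed
  then show ?thesis
    by (simp add: ext_eq_def clinear_diff[OF assms(1)])
qed

text \<open>\<open>wedge_right w x\<close> is \<open>x \<and> w\<close>.\<close>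

lift_definition wedge_right :: "'w::complex_vector \<Rightarrow> 'w ext \<Rightarrow> 'w ext"
  is "\<lambda>w. free_lin (\<lambda>ws. basis_elt (ws @ [w]))"
  by (rule ext_rels_respect[OF clinear_free_lin])
    (use ext_rels_plus ext_rels_scale ext_rels_alt in simp_all)

lemma wedge_right_wedge: "wedge_right w (wedge ws) = wedge (ws @ [w])"
  by transfer (simp add: ext_eq_def ext_rels_zero)

definition derivation_word :: "('w::complex_vector \<Rightarrow> 'w) \<Rightarrow> 'w list \<Rightarrow> ('w list \<Rightarrow>\<^sub>0 complex)"
  where "derivation_word T ws = (\<Sum>r<length ws. basis_elt (ws[r := T (ws ! r)]))"

lemma sum_lessThan_add:
  "sum g {..<m + n} = sum g {..<m} + (\<Sum>r<n. g (m + r))" for g :: "nat \<Rightarrow> 'b::comm_monoid_add"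
  by (induction n) (simp_all add: add.assoc)

lemma derivation_word_append:
  "derivation_word T (xs @ ys) =
     (\<Sum>r<length xs. basis_elt (xs[r := T (xs ! r)] @ ys)) +
     (\<Sum>r<length ys. basis_elt (xs @ ys[r := T (ys ! r)]))"
  by (simp add: derivation_word_def sum_lessThan_add nth_append list_update_append)

lemma derivation_word_append_Cons:
  "derivation_word T (xs @ w # ys) =
     (\<Sum>r<length xs. basis_elt (xs[r := T (xs ! r)] @ w # ys)) + basis_elt (xs @ T w # ys) +
     (\<Sum>r<length ys. basis_elt ((xs @ [w]) @ ys[r := T (ys ! r)]))"
  by (simp add: derivation_word_append sum.lessThan_Suc_shift add.assoc del: sum.lessThan_Suc)

text \<open>
  For linear \<open>T\<close>, the map
  \<open>w\<^sub>1 \<and> \<dots> \<and> w\<^sub>n \<mapsto> (\<Sum>r. w\<^sub>1 \<and> \<dots> \<and> T w\<^sub>r \<and> \<dots> \<and> w\<^sub>n)\<close>. The definition respects the relations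
  only for linear \<open>T\<close>; the value for other \<open>T\<close> is irrelevant.
\<close>

lift_definition derivation :: "('w::complex_vector \<Rightarrow> 'w) \<Rightarrow> 'w ext \<Rightarrow> 'w ext"
  is "\<lambda>T p. if clinear T then free_lin (derivation_word T) p else 0"
proof -
  fix T :: "'w \<Rightarrow> 'w" and p q :: "'w list \<Rightarrow>\<^sub>0 complex"
  assume eq: "ext_eq p q"
  let ?D = "free_lin (derivation_word T)"
  have "ext_eq (?D p) (?D q)" if T: "clinear T"
  proof (rule ext_rels_respect[OF clinear_free_lin _ _ _ eq])
    fix xs ys :: "'w list" and u w :: 'w and c :: complex
    let ?d = "derivation_word T"
    have "?d (xs @ (u + w) # ys) - ?d (xs @ u # ys) - ?d (xs @ w # ys) =
      (\<Sum>r<length xs. basis_elt (xs[r := T (xs ! r)] @ (u + w) # ys)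
         - basis_elt (xs[r := T (xs ! r)] @ u # ys) - basis_elt (xs[r := T (xs ! r)] @ w # ys)) +
      (basis_elt (xs @ (T u + T w) # ys) - basis_elt (xs @ T u # ys) - basis_elt (xs @ T w # ys)) +
      (\<Sum>r<length ys. basis_elt (xs @ (u + w) # ys[r := T (ys ! r)])
         - basis_elt (xs @ u # ys[r := T (ys ! r)]) - basis_elt (xs @ w # ys[r := T (ys ! r)]))"
      by (simp add: derivation_word_append_Cons clinear_add[OF T] sum_subtractf)
    also have "\<dots> \<in> ext_rels"
      by (intro ext_rels_add ext_rels_sum ext_rels_plus)
    finally show "?D (basis_elt (xs @ (u + w) # ys)) - ?D (basis_elt (xs @ u # ys))
           - ?D (basis_elt (xs @ w # ys)) \<in> ext_rels"
      by simp
    have "?d (xs @ (c *\<^sub>C u) # ys) - c *\<^sub>C ?d (xs @ u # ys) =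
      (\<Sum>r<length xs. basis_elt (xs[r := T (xs ! r)] @ (c *\<^sub>C u) # ys)
         - c *\<^sub>C basis_elt (xs[r := T (xs ! r)] @ u # ys)) +
      (basis_elt (xs @ (c *\<^sub>C T u) # ys) - c *\<^sub>C basis_elt (xs @ T u # ys)) +
      (\<Sum>r<length ys. basis_elt (xs @ (c *\<^sub>C u) # ys[r := T (ys ! r)])
         - c *\<^sub>C basis_elt (xs @ u # ys[r := T (ys ! r)]))"
      by (simp add: derivation_word_append_Cons clinear_scaleC[OF T] sum_subtractf
          scaleC_add_right complex_vector.scale_sum_right)
    also have "\<dots> \<in> ext_rels"
      by (intro ext_rels_add ext_rels_sum ext_rels_scale)
    finally show "?D (basis_elt (xs @ (c *\<^sub>C u) # ys)) - c *\<^sub>C ?D (basis_elt (xs @ u # ys))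
           \<in> ext_rels"
      by simp
    let ?t = "T w"
    have "?d (xs @ w # w # ys) =
      (\<Sum>r<length xs. basis_elt (xs[r := T (xs ! r)] @ w # w # ys)) +
      (basis_elt (xs @ ?t # w # ys) + basis_elt (xs @ w # ?t # ys)) +
      (\<Sum>r<length ys. basis_elt (xs @ w # w # ys[r := T (ys ! r)]))"
      by (simp add: derivation_word_append_Cons sum.lessThan_Suc_shift add.assoc del: sum.lessThan_Suc)
    moreover have "basis_elt (xs @ ?t # w # ys) + basis_elt (xs @ w # ?t # ys) =
      basis_elt (xs @ (w + ?t) # (w + ?t) # ys) - basis_elt (xs @ w # w # ys)
      - basis_elt (xs @ ?t # ?t # ys)
      - (basis_elt (xs @ (w + ?t) # (w + ?t) # ys) - basis_elt (xs @ w # (w + ?t) # ys)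
          - basis_elt (xs @ ?t # (w + ?t) # ys))
      - (basis_elt ((xs @ [w]) @ (w + ?t) # ys) - basis_elt ((xs @ [w]) @ w # ys)
          - basis_elt ((xs @ [w]) @ ?t # ys))
      - (basis_elt ((xs @ [?t]) @ (w + ?t) # ys) - basis_elt ((xs @ [?t]) @ w # ys)
          - basis_elt ((xs @ [?t]) @ ?t # ys))"
      by simp
    moreover have "\<dots> \<in> ext_rels"
      by (intro ext_rels_diff ext_rels_plus ext_rels_alt)
    ultimately have "?d (xs @ w # w # ys) \<in> ext_rels"
      by (simp only:) (intro ext_rels_add ext_rels_sum ext_rels_alt; assumption)
    then show "?D (basis_elt (xs @ w # w # ys)) \<in> ext_rels"
      by simp
  qed
  then show "ext_eq (if clinear T then ?D p else 0) (if clinear T then ?D q else 0)"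
    by (simp add: ext_eq_def ext_rels_zero)
qed

lemma abs_ext_sum: "abs_ext (sum g A) = (\<Sum>i\<in>A. abs_ext (g i))"
  by (induction A rule: infinite_finite_induct)
    (simp_all add: zero_ext_def plus_ext.abs_eq[symmetric])

lemma derivation_wedge:
  assumes "clinear T"
  shows "derivation T (wedge ws) = (\<Sum>r<length ws. wedge (ws[r := T (ws ! r)]))"
  by (simp add: wedge_def derivation.abs_eq assms derivation_word_def abs_ext_sum)


section \<open>Partitions\<close>

definition is_partition :: "nat list \<Rightarrow> bool"
  where "is_partition lam \<longleftrightarrow> sorted_wrt (\<ge>) lam \<and> 0 \<notin> set lam"

text \<open>Boxes are pairs (row, column), both counted from 1.\<close>

definition diagram :: "nat list \<Rightarrow> (nat \<times> nat) set"
  where "diagram lam = {(r, c). 1 \<le> r \<and> r \<le> length lam \<and> 1 \<le> c \<and> c \<le> lam ! (r - 1)}"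

text \<open>\<open>conj_part lam i\<close> is \<open>\<lambda>\<^sup>*\<^sub>i\<close> for \<open>i \<ge> 1\<close>, and \<open>conj_part lam 0 = 0\<close>.\<close>

definition conj_part :: "nat list \<Rightarrow> nat \<Rightarrow> nat"
  where "conj_part lam i = card {r. (r, i) \<in> diagram lam}"

definition num_cols :: "nat list \<Rightarrow> nat"
  where "num_cols lam = (case lam of [] \<Rightarrow> 0 | l # _ \<Rightarrow> l)"

definition appends_box :: "nat list \<Rightarrow> nat list \<Rightarrow> nat \<Rightarrow> bool"
  where "appends_box lam mu k \<longleftrightarrow>
    (\<exists>r. (r, k) \<notin> diagram lam \<and> diagram mu = insert (r, k) (diagram lam))"


section \<open>Columns and Schur modules\<close>

text \<open>
  The columns are numbered by all natural numbers, so \<open>nat \<Rightarrow>\<^sub>0 'v\<close> contains every \<open>V\<^sup>\<oplus>\<^sup>d\<close> as the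
  direct summand of the copies \<open>1, \<dots>, d\<close>. The exterior algebra of \<open>V\<^sup>\<oplus>\<^sup>d\<close> is thereby a
  subalgebra of \<open>(nat \<Rightarrow>\<^sub>0 'v) ext\<close>, and \<open>Y\<^sub>d\<close> is the sum of the \<open>Xmod \<alpha>\<close> with \<open>\<alpha>\<close> a composition
  of \<open>d\<close> supported on \<open>{1..d}\<close>. One ambient space thus serves all \<open>d\<close>.
\<close>

type_synonym 'v cols = "(nat \<Rightarrow>\<^sub>0 'v) ext"

abbreviation in_copy :: "nat \<Rightarrow> 'v::complex_vector \<Rightarrow> (nat \<Rightarrow>\<^sub>0 'v)"
  where "in_copy j v \<equiv> Poly_Mapping.single j v"

text \<open>
  \<open>\<Lambda>\<^bsup>\<alpha>\<^sub>1\<^esup>V \<otimes> \<Lambda>\<^bsup>\<alpha>\<^sub>2\<^esup>V \<otimes> \<dots>\<close> inside the exterior algebra: spanned by the wedge products of first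
  \<open>\<alpha>\<^sub>1\<close> vectors from copy 1, then \<open>\<alpha>\<^sub>2\<close> vectors from copy 2, and so on.
\<close>

definition Xmod :: "(nat \<Rightarrow> nat) \<Rightarrow> 'v::complex_vector cols set" where
  "Xmod \<alpha> = cspan {wedge (map (\<lambda>(j, v). in_copy j v) js) | js.
     sorted (map fst js) \<and> (\<forall>j. count_list (map fst js) j = \<alpha> j)}"

definition sigma :: "nat \<Rightarrow> nat \<Rightarrow> 'v::complex_vector cols \<Rightarrow> 'v cols"
  where "sigma i j = derivation (\<lambda>w. in_copy j (Poly_Mapping.lookup w i))"

lemma clinear_move_copy: "clinear (\<lambda>w. in_copy j (Poly_Mapping.lookup w i))"
  by (rule clinearI)
    (simp_all add: poly_mapping_eq_iff fun_eq_iff lookup_add lookup_single when_def)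

lemma sigma_wedge:
  "sigma i j (wedge ws) = (\<Sum>r<length ws. wedge (ws[r := in_copy j (Poly_Mapping.lookup (ws ! r) i)]))"
  unfolding sigma_def by (rule derivation_wedge[OF clinear_move_copy])

definition Imod :: "nat list \<Rightarrow> 'v::complex_vector cols set" where
  "Imod lam = cspan (\<Union>i\<in>{i. 1 \<le> i \<and> conj_part lam (i + 1) > 0}.
     sigma i (i + 1) ` Xmod ((conj_part lam)
       (i := conj_part lam i + 1, i + 1 := conj_part lam (i + 1) - 1)))"

text \<open>
  The identification of \<open>V \<otimes> Xmod \<lambda>\<^sup>*\<close> with \<open>Xmod (\<lambda>\<^sup>*,1)\<close>: the factor from \<open>V\<close> becomes the
  single entry of column \<open>\<lambda>\<^sub>1 + 1\<close>, which is the last one.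
\<close>

definition place :: "nat list \<Rightarrow> 'v::complex_vector \<Rightarrow> 'v cols \<Rightarrow> 'v cols"
  where "place lam v x = wedge_right (in_copy (num_cols lam + 1) v) x"

text \<open>For a subspace \<open>U\<close> of \<open>Xmod \<lambda>\<^sup>*\<close>, the subspace of \<open>Xmod (\<lambda>\<^sup>*,1)\<close> identified with \<open>V \<otimes> U\<close>.\<close>

definition V_tensor :: "nat list \<Rightarrow> 'v::complex_vector cols set \<Rightarrow> 'v cols set"
  where "V_tensor lam U = cspan {place lam v x | v x. x \<in> U}"


section \<open>The map \<open>\<zeta>\<close>\<close>

definition decr_seqs :: "nat \<Rightarrow> nat \<Rightarrow> nat list set" where
  "decr_seqs m k =
     {J. J \<noteq> [] \<and> sorted_wrt (>) J \<and> 0 \<notin> set J \<and> hd J = m \<and> last J = k}"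

fun sigma_seq :: "nat list \<Rightarrow> 'v::complex_vector cols \<Rightarrow> 'v cols" where
  "sigma_seq (i # j # J) = sigma i j \<circ> sigma_seq (j # J)"
| "sigma_seq _ = id"

text \<open>Lists are indexed from 0, so the indices \<open>1 \<le> q < p - 1\<close> are the interior ones.\<close>

definition D_factor :: "(nat \<Rightarrow> nat) \<Rightarrow> nat \<Rightarrow> nat list \<Rightarrow> int" where
  "D_factor \<alpha> k J =
     (\<Prod>q\<in>{1..<length J - 1}. int (\<alpha> k) - int (\<alpha> (J ! q)) + int (J ! q) - int k + 1)"

definition zeta :: "nat list \<Rightarrow> nat \<Rightarrow> 'v::complex_vector cols \<Rightarrow> 'v cols" where
  "zeta lam k x = (\<Sum>J\<in>decr_seqs (num_cols lam + 1) k.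
     (1 / of_int (D_factor (conj_part lam) k J)) *\<^sub>C sigma_seq J x)"


section \<open>Quotient spaces and tensor products with them\<close>

definition coset :: "'a::complex_vector set \<Rightarrow> 'a \<Rightarrow> 'a set"
  where "coset I x = (+) x ` I"

definition quot :: "'a::complex_vector set \<Rightarrow> 'a set \<Rightarrow> 'a set set"
  where "quot X I = coset I ` X"

definition Schur :: "nat list \<Rightarrow> 'v::complex_vector cols set set"
  where "Schur lam = quot (Xmod (conj_part lam)) (Imod lam)"

text \<open>Linearity of a map between the quotient spaces \<open>X/I\<close> and \<open>Y/J\<close>.\<close>

definition quot_linear ::
  "'a::complex_vector set \<Rightarrow> 'a set \<Rightarrow> 'b::complex_vector set \<Rightarrow> 'b set \<Rightarrow> ('a set \<Rightarrow> 'b set) \<Rightarrow> bool"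
  where "quot_linear X I Y J \<phi> \<longleftrightarrow>
    \<phi> \<in> quot X I \<rightarrow> quot Y J \<and>
    (\<forall>x\<in>X. \<forall>x'\<in>X. \<forall>y\<in>\<phi> (coset I x). \<forall>y'\<in>\<phi> (coset I x').
       \<phi> (coset I (x + x')) = coset J (y + y')) \<and>
    (\<forall>c. \<forall>x\<in>X. \<forall>y\<in>\<phi> (coset I x). \<phi> (coset I (c *\<^sub>C x)) = coset J (c *\<^sub>C y))"

text \<open>
  The tensor product of \<open>'v\<close> with a quotient space \<open>X/I\<close> is the free vector space on the set
  \<open>'v \<times> X/I\<close> modulo the bilinearity relations.
\<close>

definition tensor_free :: "'e::complex_vector set \<Rightarrow> 'e set \<Rightarrow> ('v \<times> 'e set \<Rightarrow>\<^sub>0 complex) set"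
  where "tensor_free X I = cspan {basis_elt (v, A) | v A. A \<in> quot X I}"

definition tensor_rels ::
  "'e::complex_vector set \<Rightarrow> 'e set \<Rightarrow> ('v::complex_vector \<times> 'e set \<Rightarrow>\<^sub>0 complex) set"
  where "tensor_rels X I = cspan (
    {basis_elt (v + w, A) - basis_elt (v, A) - basis_elt (w, A) | v w A. A \<in> quot X I} \<union>
    {basis_elt (c *\<^sub>C v, A) - c *\<^sub>C basis_elt (v, A) | c v A. A \<in> quot X I} \<union>
    {basis_elt (v, coset I (x + y)) - basis_elt (v, coset I x) - basis_elt (v, coset I y)
       | v x y. x \<in> X \<and> y \<in> X} \<union>
    {basis_elt (v, coset I (c *\<^sub>C x)) - c *\<^sub>C basis_elt (v, coset I x) | v c x. x \<in> X})"

definition V_tensor_quot ::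
  "'e::complex_vector set \<Rightarrow> 'e set \<Rightarrow> ('v::complex_vector \<times> 'e set \<Rightarrow>\<^sub>0 complex) set set"
  where "V_tensor_quot X I = quot (tensor_free X I) (tensor_rels X I)"

definition pure_tensor ::
  "'e::complex_vector set \<Rightarrow> 'e set \<Rightarrow> 'v::complex_vector \<Rightarrow> 'e set \<Rightarrow>
     ('v \<times> 'e set \<Rightarrow>\<^sub>0 complex) set"
  where "pure_tensor X I v A = coset (tensor_rels X I) (basis_elt (v, A))"

text \<open>
  \<open>induced_by_zeta lam mu k \<phi>\<close>: \<open>\<phi>\<close> is a linear map \<open>V \<otimes> S\<^sup>\<lambda>V \<rightarrow> S\<^sup>\<mu>V\<close> (set to \<open>undefined\<close>
  outside its domain) with \<open>\<phi> (v \<otimes> [x]) = [\<zeta> (v \<otimes> x)]\<close>.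
\<close>

definition induced_by_zeta ::
  "nat list \<Rightarrow> nat list \<Rightarrow> nat \<Rightarrow>
     (('v::complex_vector \<times> 'v cols set \<Rightarrow>\<^sub>0 complex) set \<Rightarrow> 'v cols set) \<Rightarrow> bool"
  where "induced_by_zeta lam mu k \<phi> \<longleftrightarrow>
    \<phi> \<in> V_tensor_quot (Xmod (conj_part lam)) (Imod lam) \<rightarrow>\<^sub>E Schur mu \<and>
    quot_linear (tensor_free (Xmod (conj_part lam)) (Imod lam))
      (tensor_rels (Xmod (conj_part lam)) (Imod lam))
      (Xmod (conj_part mu)) (Imod mu) \<phi> \<and>
    (\<forall>v. \<forall>x\<in>Xmod (conj_part lam).
       \<phi> (pure_tensor (Xmod (conj_part lam)) (Imod lam) v (coset (Imod lam) x)) =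
         coset (Imod mu) (zeta lam k (place lam v x)))"

end

(*
  The maps sigma satisfy the commutation relations of the Lie algebra gl acting on the column
  indices, and the spaces X^alpha V are the weight spaces. Let zeta_j be the sum defining zeta with paths from j
  to k instead of from lambda_1 + 1 to k. Then zeta_j is a combination of the sigma_{j,l} zeta_l
  with k <= l < j. Induction on j shows that, on vectors of weight (lambda^*,1) + e_i - e_{i+1},
  zeta_j commutes with sigma_{i,i+1} unless j = i + 1; the denominators are chosen so that the
  defect at j = i + 1 disappears again for larger j. Since i + 1 <= lambda_1, the map zeta commutes
  with sigma_{i,i+1} and so sends generators of I^lambda to generators of I^mu.
*)

theory Submission
  imports Defs "HOL-Library.Multiset"
begin

section \<open>The exterior algebra\<close>

text \<open>Words form a basis of the free algebra, and the quotient map sends each word to its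
  \<open>wedge\<close>. Linear identities on the exterior algebra can thus be checked on single
  wedge products.\<close>

lemma span_wedge: "x \<in> cspan (range wedge)"
proof (induction x rule: ext.abs_induct)
  case (1 p)
  have "p = (\<Sum>ws\<in>Poly_Mapping.keys p. Poly_Mapping.lookup p ws *\<^sub>C basis_elt ws)"
    by (rule poly_mapping_eqI)
      (auto simp: lookup_sum lookup_single when_def scaleC_complex_def in_keys_iff sum.delta
        if_distrib[of "\<lambda>x. _ * x"] cong: if_cong)
  then have "abs_ext p = (\<Sum>ws\<in>Poly_Mapping.keys p. Poly_Mapping.lookup p ws *\<^sub>C wedge ws)"
    by (metis (no_types, lifting) abs_ext_sum scaleC_ext.abs_eq sum.cong wedge.abs_eq)
  then show ?case
    by (simp add: complex_vector.span_sum complex_vector.span_scale complex_vector.span_base)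
qed

section \<open>Linear maps and their values on spanning sets\<close>

lemma clinear_zero: "clinear f \<Longrightarrow> f 0 = 0"
  using clinear_diff[of f 0 0] by simp

lemma clinear_sum: "clinear f \<Longrightarrow> f (sum g A) = (\<Sum>i\<in>A. f (g i))"
  by (induction A rule: infinite_finite_induct) (simp_all add: clinear_zero clinear_add)

lemma clinear_id: "clinear (\<lambda>x. x)"
  by (rule clinearI) simp_all

lemma clinear_compose: "clinear f \<Longrightarrow> clinear g \<Longrightarrow> clinear (\<lambda>x. f (g x))"
  by (rule clinearI) (simp_all add: clinear_add clinear_scaleC)

lemma clinear_plus: "clinear f \<Longrightarrow> clinear g \<Longrightarrow> clinear (\<lambda>x. f x + g x)"
  by (rule clinearI) (simp_all add: clinear_add clinear_scaleC scaleC_add_right algebra_simps)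

lemma clinear_minus: "clinear f \<Longrightarrow> clinear g \<Longrightarrow> clinear (\<lambda>x. f x - g x)"
  by (rule clinearI)
    (simp_all add: clinear_add clinear_scaleC complex_vector.scale_right_diff_distrib algebra_simps)

lemma clinear_eq_on_span:
  assumes "clinear f" "clinear g" "\<And>x. x \<in> A \<Longrightarrow> f x = g x" "x \<in> cspan A"
  shows "f x = g x"
proof -
  \<comment> \<open>The span of the empty set is zero, so membership in it encodes the
    equality.\<close>
  have "f x - g x \<in> cspan {}"
    by (rule clinear_image_span[of "\<lambda>x. f x - g x" A])
      (use assms in \<open>auto intro: clinear_minus\<close>)
  then show ?thesis
    by simp
qed

lemma clinear_scale: "clinear f \<Longrightarrow> clinear (\<lambda>x. c *\<^sub>C f x)"
  by (rule clinearI) (simp_all add: clinear_add clinear_scaleC scaleC_add_right scaleC_scaleC mult.commute)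

lemma clinear_const_zero: "clinear (\<lambda>x. 0)"
  by (rule clinearI) simp_all

lemma clinear_setsum: "(\<And>i. i \<in> A \<Longrightarrow> clinear (f i)) \<Longrightarrow> clinear (\<lambda>x. \<Sum>i\<in>A. f i x)"
  by (induction A rule: infinite_finite_induct) (simp_all add: clinear_const_zero clinear_plus)

lemma clinear_wedge_right: "clinear (wedge_right w)"
  by (rule clinearI; transfer)
    (simp_all add: clinear_add[OF clinear_free_lin] clinear_scaleC[OF clinear_free_lin] ext_eq_def
      ext_rels_zero)

text \<open>For non-linear \<open>T\<close> the derivation is the zero map by its definition, hence
  linear in that case too.\<close>

lemma clinear_derivation: "clinear (derivation T)"
  by (rule clinearI; transfer)
    (simp_all add: clinear_add[OF clinear_free_lin] clinear_scaleC[OF clinear_free_lin] ext_eq_def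
      ext_rels_zero)

lemma clinear_sigma: "clinear (sigma i j)"
  unfolding sigma_def by (rule clinear_derivation)

lemma ext_eqI:
  assumes "clinear f" "clinear g" "\<And>ws. f (wedge ws) = g (wedge ws)"
  shows "f x = g x"
  by (rule clinear_eq_on_span[OF assms(1,2) _ span_wedge]) (use assms(3) in auto)

section \<open>Multilinearity and antisymmetry of wedge products\<close>

lemma wedge_add: "wedge (xs @ (u + w) # ys) = wedge (xs @ u # ys) + wedge (xs @ w # ys)"
  by transfer (use ext_rels_plus in \<open>simp add: ext_eq_def diff_diff_eq\<close>)

lemma wedge_scale: "wedge (xs @ (c *\<^sub>C u) # ys) = c *\<^sub>C wedge (xs @ u # ys)"
  by transfer (use ext_rels_scale in \<open>simp add: ext_eq_def\<close>)

lemma wedge_alternating: "wedge (xs @ w # w # ys) = 0"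
  by transfer (use ext_rels_alt in \<open>simp add: ext_eq_def\<close>)

text \<open>Polarization: the product with the repeated neighbour \<open>u + w\<close> vanishes, and
  its expansion leaves only the two mixed terms.\<close>

lemma wedge_swap: "wedge (xs @ u # w # ys) = - wedge (xs @ w # u # ys)"
proof -
  have "0 = wedge (xs @ (u + w) # (u + w) # ys)"
    by (simp add: wedge_alternating)
  also have "\<dots> = wedge (xs @ u # w # ys) + wedge (xs @ w # u # ys)"
    using wedge_add[of "xs @ [u]" u w ys] wedge_add[of "xs @ [w]" u w ys]
    using wedge_add[of xs u w "(u + w) # ys"] by (simp add: wedge_alternating)
  finally show ?thesis
    by (simp add: eq_neg_iff_add_eq_0)
qed

lemma wedge_right_add: "wedge_right (u + w) x = wedge_right u x + wedge_right w x"
  by (rule ext_eqI) (simp_all add: clinear_wedge_right clinear_plus wedge_right_wedge wedge_add)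

lemma wedge_right_scale: "wedge_right (c *\<^sub>C w) x = c *\<^sub>C wedge_right w x"
  by (rule ext_eqI) (simp_all add: clinear_wedge_right clinear_scale wedge_right_wedge wedge_scale)

lemma wedge_right_zero: "wedge_right 0 x = 0"
  using wedge_right_scale[of 0 0 x] by simp

section \<open>The operators \<open>sigma\<close> and the relations of gl\<close>

lemma sigma_wedge_Nil: "sigma i j (wedge []) = 0"
  by (simp add: sigma_wedge)

text \<open>Leibniz rule for a last factor \<open>w\<close>: the operator acts either on
  \<open>x\<close> or on \<open>w\<close>. It replaces the sum over positions in the inductions from
  the right below.\<close>

lemma sigma_wedge_right:
  "sigma i j (wedge_right w x) =
     wedge_right w (sigma i j x) + wedge_right (in_copy j (Poly_Mapping.lookup w i)) x"
  by (rule ext_eqI)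
    (simp_all add: clinear_plus clinear_compose[OF clinear_wedge_right] clinear_wedge_right
      clinear_compose[OF clinear_sigma] clinear_sigma wedge_right_wedge sigma_wedge
      clinear_sum[OF clinear_wedge_right] nth_append list_update_append)

lemma sigma_commutator:
  "sigma c d (sigma a b x) = sigma a b (sigma c d x)
     + (if b = c then sigma a d x else 0) - (if d = a then sigma c b x else 0)"
proof (rule ext_eqI[where x = x])
  show "sigma c d (sigma a b (wedge ws)) = sigma a b (sigma c d (wedge ws))
     + (if b = c then sigma a d (wedge ws) else 0) - (if d = a then sigma c b (wedge ws) else 0)"
    for ws :: "(nat \<Rightarrow>\<^sub>0 'a) list"
    \<comment> \<open>The mixed terms, with one operator on the last factor and the other on the
      rest, agree on both sides. What remains is the induction hypothesis and the commutator of two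
      elementary matrices on one vector.\<close>
    by (induction ws rule: rev_induct)
      (auto simp: sigma_wedge_Nil clinear_zero[OF clinear_sigma] wedge_right_wedge[symmetric]
        sigma_wedge_right clinear_add[OF clinear_sigma] clinear_add[OF clinear_wedge_right]
        clinear_diff[OF clinear_wedge_right] lookup_single wedge_right_zero
        clinear_zero[OF clinear_wedge_right])
qed (cases "b = c"; cases "d = a"; auto intro!: clinear_plus clinear_minus
      clinear_compose[OF clinear_sigma] clinear_sigma)+


section \<open>Weight spaces\<close>

text \<open>
  Integer weights make \<open>sigma i j\<close> shift weights without exception: a weight with a negative entry
  has weight space \<open>{0}\<close>.
\<close>

definition col_word :: "(nat \<times> 'v::complex_vector) list \<Rightarrow> (nat \<Rightarrow>\<^sub>0 'v) list"
  where "col_word = map (\<lambda>(j, v). in_copy j v)"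

definition weight_space :: "(nat \<Rightarrow> int) \<Rightarrow> 'v::complex_vector cols set" where
  "weight_space \<alpha> =
     cspan {wedge (col_word js) | js. \<forall>j. int (count_list (map fst js) j) = \<alpha> j}"

lemma weight_space_zero: "0 \<in> weight_space \<alpha>"
  and weight_space_add: "x \<in> weight_space \<alpha> \<Longrightarrow> y \<in> weight_space \<alpha> \<Longrightarrow> x + y \<in> weight_space \<alpha>"
  and weight_space_scale: "x \<in> weight_space \<alpha> \<Longrightarrow> c *\<^sub>C x \<in> weight_space \<alpha>"
  and weight_space_sum:
    "(\<And>i. i \<in> A \<Longrightarrow> g i \<in> weight_space \<alpha>) \<Longrightarrow> sum g A \<in> weight_space \<alpha>"
  unfolding weight_space_def
  by (auto simp: complex_vector.span_zero complex_vector.span_add complex_vector.span_scale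
      intro: complex_vector.span_sum)

lemma wedge_right_weight_space:
  assumes "x \<in> weight_space \<alpha>"
  shows "wedge_right (in_copy j v) x \<in> weight_space (\<lambda>l. \<alpha> l + of_bool (l = j))"
  unfolding weight_space_def
proof (rule clinear_image_span[OF clinear_wedge_right _ assms[unfolded weight_space_def]])
  fix y :: "'a cols"
  assume "y \<in> {wedge (col_word js) | js. \<forall>j. int (count_list (map fst js) j) = \<alpha> j}"
  then obtain js where js: "y = wedge (col_word js)" "\<And>j. int (count_list (map fst js) j) = \<alpha> j"
    by auto
  have "wedge_right (in_copy j v) y = wedge (col_word (js @ [(j, v)]))"
    by (simp add: js wedge_right_wedge col_word_def)
  moreover have "\<forall>l. int (count_list (map fst (js @ [(j, v)])) l) = \<alpha> l + of_bool (l = j)"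
    using js(2) by auto
  ultimately show "wedge_right (in_copy j v) y \<in> cspan {wedge (col_word js) | js.
      \<forall>l. int (count_list (map fst js) l) = \<alpha> l + of_bool (l = j)}"
    by (blast intro: complex_vector.span_base)
qed

lemma sigma_col_word:
  fixes js :: "(nat \<times> 'v::complex_vector) list"
  shows "sigma i j (wedge (col_word js)) \<in> weight_space
     (\<lambda>l. int (count_list (map fst js) l) - of_bool (l = i) + of_bool (l = j))"
proof (induction js rule: rev_induct)
  case Nil
  then show ?case
    by (simp add: col_word_def sigma_wedge_Nil weight_space_zero)
next
  case (snoc p js)
  obtain c v where p: "p = (c, v)"
    by force
  let ?x = "wedge (col_word js)"
  let ?\<beta> = "\<lambda>l. int (count_list (map fst (js @ [p])) l) - of_bool (l = i) + of_bool (l = j)"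
  have x: "?x \<in> weight_space (\<lambda>l. int (count_list (map fst js) l))"
    unfolding weight_space_def by (rule complex_vector.span_base) auto
  have "wedge_right (in_copy c v) (sigma i j ?x) \<in> weight_space ?\<beta>"
    using wedge_right_weight_space[OF snoc, of c v]
    by (rule back_subst[of "\<lambda>\<alpha>. _ \<in> weight_space \<alpha>"]) (auto simp: p fun_eq_iff)
  moreover have "wedge_right (in_copy j (Poly_Mapping.lookup (in_copy c v) i)) ?x \<in> weight_space ?\<beta>"
  \<comment> \<open>Only a last factor in column \<open>i\<close> survives, and it moves to column
    \<open>j\<close>. Otherwise the term is 0, which lies in every weight space.\<close>
  proof (cases "c = i")
    case True
    show ?thesis
      using wedge_right_weight_space[OF x, of j v]
      by (rule back_subst[of "\<lambda>y. y \<in> _", THEN back_subst[of "\<lambda>\<alpha>. _ \<in> weight_space \<alpha>"]])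
        (auto simp: p True fun_eq_iff)
  qed (simp add: lookup_single wedge_right_zero weight_space_zero)
  ultimately show ?case
    by (simp add: p col_word_def wedge_right_wedge[symmetric] sigma_wedge_right weight_space_add)
qed

lemma sigma_weight_space:
  assumes "x \<in> weight_space \<alpha>"
  shows "sigma i j x \<in> weight_space (\<lambda>l. \<alpha> l - of_bool (l = i) + of_bool (l = j))"
  unfolding weight_space_def
proof (rule clinear_image_span[OF clinear_sigma _ assms[unfolded weight_space_def]])
  fix y :: "'a cols"
  assume "y \<in> {wedge (col_word js) | js. \<forall>j. int (count_list (map fst js) j) = \<alpha> j}"
  then obtain js where "y = wedge (col_word js)" "\<alpha> = (\<lambda>l. int (count_list (map fst js) l))"
    by auto
  then show "sigma i j y \<in> cspan {wedge (col_word js) | js.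
      \<forall>l. int (count_list (map fst js) l) = \<alpha> l - of_bool (l = i) + of_bool (l = j)}"
    using sigma_col_word[of i j js] by (simp add: weight_space_def)
qed

text \<open>Each box of column \<open>i\<close> reproduces the word once, and boxes elsewhere are
  killed. These are the diagonal operators of gl, from which weights can be read off.\<close>

lemma sigma_diag_col_word:
  "sigma i i (wedge (col_word js)) = of_nat (count_list (map fst js) i) *\<^sub>C wedge (col_word js)"
  by (induction js rule: rev_induct)
    (auto simp: col_word_def sigma_wedge_Nil wedge_right_wedge[symmetric] sigma_wedge_right
      clinear_scaleC[OF clinear_wedge_right] lookup_single scaleC_add_left scaleC_one
      wedge_right_zero add.commute)

lemma sigma_diag:
  assumes "x \<in> weight_space \<alpha>"
  shows "sigma i i x = of_int (\<alpha> i) *\<^sub>C x"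
proof (rule clinear_eq_on_span[OF clinear_sigma _ _ assms[unfolded weight_space_def]])
  fix y :: "'a cols"
  assume "y \<in> {wedge (col_word js) | js. \<forall>j. int (count_list (map fst js) j) = \<alpha> j}"
  then obtain js where "y = wedge (col_word js)" "int (count_list (map fst js) i) = \<alpha> i"
    by auto
  then show "sigma i i y = of_int (\<alpha> i) *\<^sub>C y"
    by (metis of_int_of_nat_eq sigma_diag_col_word)
qed (intro clinear_scale clinear_id)

text \<open>Every adjacent swap only changes the sign. The arbitrary prefix \<open>us\<close> lets
  the induction pass over \<open>q\<close> by moving it into the prefix.\<close>

lemma wedge_insort:
  "\<exists>c. wedge (us @ col_word (p # js)) = c *\<^sub>C wedge (us @ col_word (insort_key fst p js))"
proof (induction js arbitrary: us)
  case Nil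
  show ?case
    by (rule exI[of _ 1]) (simp add: scaleC_one)
next
  case (Cons q js)
  show ?case
  proof (cases "fst p \<le> fst q")
    case True
    then show ?thesis
      by (intro exI[of _ 1]) (simp add: scaleC_one)
  next
    case False
    let ?q = "col_word [q]"
    obtain c where c: "wedge ((us @ ?q) @ col_word (p # js)) =
        c *\<^sub>C wedge ((us @ ?q) @ col_word (insort_key fst p js))"
      using Cons.IH by blast
    have "wedge (us @ col_word (p # q # js)) = - wedge ((us @ ?q) @ col_word (p # js))"
      using wedge_swap[of us "in_copy (fst p) (snd p)" "in_copy (fst q) (snd q)" "col_word js"]
      by (simp add: col_word_def case_prod_beta)
    also have "\<dots> = (- c) *\<^sub>C wedge (us @ col_word (insort_key fst p (q # js)))"
      using False unfolding c by (simp add: col_word_def)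
    finally show ?thesis
      by blast
  qed
qed

lemma wedge_sort:
  "\<exists>c. wedge (us @ col_word js) = c *\<^sub>C wedge (us @ col_word (sort_key fst js))"
proof (induction js arbitrary: us)
  case Nil
  show ?case
    by (rule exI[of _ 1]) (simp add: scaleC_one)
next
  case (Cons p js)
  obtain c where "wedge ((us @ col_word [p]) @ col_word js) =
      c *\<^sub>C wedge ((us @ col_word [p]) @ col_word (sort_key fst js))"
    using Cons.IH by blast
  then have "wedge (us @ col_word (p # js)) = c *\<^sub>C wedge (us @ col_word (p # sort_key fst js))"
    by (simp add: col_word_def)
  moreover obtain c' where "wedge (us @ col_word (p # sort_key fst js)) =
      c' *\<^sub>C wedge (us @ col_word (insort_key fst p (sort_key fst js)))"
    using wedge_insort by blast
  ultimately show ?case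
    by (auto simp: scaleC_scaleC)
qed

lemma subspace_Xmod: "complex_vector.subspace (Xmod \<alpha>)"
  unfolding Xmod_def by (rule complex_vector.subspace_span)

text \<open>Sorting the factors of a word by column changes its wedge product by a scalar and
  preserves the column counts. The unsorted generators of \<open>weight_space\<close> are the
  convenient ones, since appending a factor or applying \<open>sigma\<close> destroys the
  order.\<close>

lemma Xmod_eq_weight_space: "Xmod \<alpha> = (weight_space (\<lambda>j. int (\<alpha> j)) :: 'v::complex_vector cols set)"
proof
  show "Xmod \<alpha> \<subseteq> (weight_space (\<lambda>j. int (\<alpha> j)) :: 'v cols set)"
    unfolding Xmod_def weight_space_def col_word_def
    by (rule complex_vector.span_mono) auto
  have "wedge (col_word js) \<in> Xmod \<alpha>" if "\<forall>j. count_list (map fst js) j = \<alpha> j"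
    for js :: "(nat \<times> 'v) list"
  proof -
    obtain c where c: "wedge (col_word js) = c *\<^sub>C wedge (col_word (sort_key fst js))"
      using wedge_sort[of "[]" js] by auto
    have "mset (map fst (sort_key fst js)) = mset (map fst js)"
      by simp
    then have "count_list (map fst (sort_key fst js)) j = \<alpha> j" for j
      using that by (simp add: count_mset[symmetric] del: mset_map)
    then have "wedge (col_word (sort_key fst js)) \<in> Xmod \<alpha>"
      unfolding Xmod_def col_word_def by (intro complex_vector.span_base) force
    then show ?thesis
      unfolding c Xmod_def by (rule complex_vector.span_scale)
  qed
  then show "(weight_space (\<lambda>j. int (\<alpha> j)) :: 'v cols set) \<subseteq> Xmod \<alpha>"
    unfolding weight_space_def
    by (intro complex_vector.span_minimal)
      (auto simp: subspace_Xmod)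
qed


section \<open>Recursion for the map \<open>\<zeta>\<close>\<close>

definition zeta_from :: "(nat \<Rightarrow> nat) \<Rightarrow> nat \<Rightarrow> nat \<Rightarrow> 'v::complex_vector cols \<Rightarrow> 'v cols" where
  "zeta_from \<alpha> k j x =
     (\<Sum>J\<in>decr_seqs j k. (1 / of_int (D_factor \<alpha> k J)) *\<^sub>C sigma_seq J x)"

text \<open>For \<open>k < l\<close> this is one plus the content difference of the boxes just below
  columns \<open>l\<close> and \<open>k\<close>. It is the factor that an interior entry
  \<open>l\<close> of a path contributes to \<open>D_factor\<close>; the value 1 at
  \<open>l = k\<close> accounts for the end point, which contributes none.\<close>

definition hook :: "(nat \<Rightarrow> nat) \<Rightarrow> nat \<Rightarrow> nat \<Rightarrow> int"
  where "hook \<alpha> k l = (if l = k then 1 else int (\<alpha> k) - int (\<alpha> l) + int l - int k + 1)"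

section \<open>Decreasing paths and their denominators\<close>

lemma decr_seqs_Cons_iff:
  "J \<in> decr_seqs j k \<longleftrightarrow>
     0 < j \<and> (J = [j] \<and> j = k \<or> (\<exists>l J'. J = j # J' \<and> l < j \<and> J' \<in> decr_seqs l k))"
proof (cases J)
  case (Cons a J')
  then show ?thesis
  proof (cases J')
    case (Cons b J'')
    \<comment> \<open>\<open>sorted_wrt\<close> compares the head with the whole tail; by
      transitivity the comparison with the next entry suffices.\<close>
    have "b < a \<Longrightarrow> \<forall>y\<in>set J''. y < b \<Longrightarrow> \<forall>y\<in>set J''. y < a"
      by auto
    then show ?thesis
      using Cons \<open>J = a # J'\<close> by (auto simp: decr_seqs_def)
  qed (auto simp: decr_seqs_def)
qed (simp add: decr_seqs_def)

lemma decr_seqs_ge: "J \<in> decr_seqs j k \<Longrightarrow> k \<le> j"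
proof (induction J arbitrary: j)
  case (Cons a J)
  then show ?case
    using decr_seqs_Cons_iff[of "a # J" j k] by fastforce
qed (simp add: decr_seqs_def)

lemma decr_seqs_self: "0 < k \<Longrightarrow> decr_seqs k k = {[k]}"
  using decr_seqs_Cons_iff[of _ k k] decr_seqs_ge by fastforce

lemma decr_seqs_rec:
  assumes "k < j"
  shows "decr_seqs j k = (\<Union>l\<in>{k..<j}. (#) j ` decr_seqs l k)"
proof -
  have "J \<in> decr_seqs j k \<longleftrightarrow> (\<exists>l\<in>{k..<j}. \<exists>J'\<in>decr_seqs l k. J = j # J')" for J
    using assms decr_seqs_ge by (subst decr_seqs_Cons_iff) fastforce
  then show ?thesis
    by blast
qed

lemma finite_decr_seqs: "finite (decr_seqs j k)"
proof (induction j rule: less_induct)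
  case (less j)
  have "decr_seqs j k \<subseteq> insert [j] (\<Union>l\<in>{..<j}. (#) j ` decr_seqs l k)"
  proof
    fix J
    assume "J \<in> decr_seqs j k"
    then show "J \<in> insert [j] (\<Union>l\<in>{..<j}. (#) j ` decr_seqs l k)"
      by (subst (asm) decr_seqs_Cons_iff) auto
  qed
  then show ?case
    by (rule finite_subset) (use less in auto)
qed

text \<open>Prepending \<open>j\<close> turns the former head \<open>l\<close> into an interior
  entry, so exactly one factor is new. If \<open>J\<close> is just the end point, that factor is
  1.\<close>

lemma D_factor_Cons:
  assumes "J \<in> decr_seqs l k"
  shows "D_factor \<alpha> k (j # J) = hook \<alpha> k l * D_factor \<alpha> k J"
proof (cases "tl J = []")
  case True
  then have "J = [l]" "l = k"
    using assms by (cases J; auto simp: decr_seqs_def)+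
  then show ?thesis
    by (simp add: D_factor_def hook_def)
next
  case False
  then obtain J' where J: "J = l # J'" "J' \<noteq> []"
    using assms by (cases J) (auto simp: decr_seqs_def)
  then have "k < l"
    using assms last_in_set[of J'] by (auto simp: decr_seqs_def)
  define g where "g i = int (\<alpha> k) - int (\<alpha> i) + int i - int k + 1" for i
  have "D_factor \<alpha> k (j # J) = (\<Prod>q\<in>{Suc 0..<Suc (length J')}. g ((j # J) ! q))"
    by (simp add: D_factor_def g_def J)
  \<comment> \<open>The interior positions of \<open>j # J\<close> are all positions of
    \<open>J\<close> but the last, shifted by one.\<close>
  also have "\<dots> = (\<Prod>q\<in>{0..<length J'}. g (J ! q))"
    by (subst prod.shift_bounds_Suc_ivl) simp
  also have "\<dots> = g (J ! 0) * (\<Prod>q\<in>{Suc 0..<length J'}. g (J ! q))"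
    using J(2) by (subst prod.atLeast_Suc_lessThan) auto
  finally show ?thesis
    using \<open>k < l\<close> by (simp add: D_factor_def hook_def g_def J)
qed

lemma zeta_from_self: "0 < k \<Longrightarrow> zeta_from \<alpha> k k x = x"
  by (simp add: zeta_from_def decr_seqs_self D_factor_def)

lemma zeta_from_below: "j < k \<Longrightarrow> zeta_from \<alpha> k j x = 0"
  unfolding zeta_from_def by (rule sum.neutral) (auto dest: decr_seqs_ge)

text \<open>Group the paths by their second entry \<open>l\<close>. The first step factors out as
  \<open>sigma j l\<close>, and the rest of the path runs over \<open>decr_seqs l k\<close>.\<close>

lemma zeta_from_rec:
  assumes "k < j"
  shows "zeta_from \<alpha> k j x =
    (\<Sum>l\<in>{k..<j}. (1 / of_int (hook \<alpha> k l)) *\<^sub>C sigma j l (zeta_from \<alpha> k l x))"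
proof -
  let ?t = "\<lambda>J. (1 / of_int (D_factor \<alpha> k J)) *\<^sub>C sigma_seq J x"
  have "zeta_from \<alpha> k j x = (\<Sum>l\<in>{k..<j}. \<Sum>J\<in>(#) j ` decr_seqs l k. ?t J)"
    unfolding zeta_from_def decr_seqs_rec[OF assms]
    by (rule sum.UNION_disjoint) (auto simp: finite_decr_seqs, auto simp: decr_seqs_def)
  also have "\<dots> = (\<Sum>l\<in>{k..<j}. \<Sum>J\<in>decr_seqs l k. ?t (j # J))"
    by (simp add: sum.reindex)
  also have "\<dots> = (\<Sum>l\<in>{k..<j}.
      (1 / of_int (hook \<alpha> k l)) *\<^sub>C sigma j l (zeta_from \<alpha> k l x))"
  proof (rule sum.cong[OF refl])
    fix l
    have "?t (j # J) = (1 / of_int (hook \<alpha> k l)) *\<^sub>C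
        sigma j l ((1 / of_int (D_factor \<alpha> k J)) *\<^sub>C sigma_seq J x)" if J: "J \<in> decr_seqs l k" for J
    proof -
      obtain J' where "J = l # J'"
        using J by (cases J) (auto simp: decr_seqs_def)
      then show ?thesis
        by (simp add: D_factor_Cons[OF J, unfolded \<open>J = l # J'\<close>]
            clinear_scaleC[OF clinear_sigma])
    qed
    then show "(\<Sum>J\<in>decr_seqs l k. ?t (j # J)) =
        (1 / of_int (hook \<alpha> k l)) *\<^sub>C sigma j l (zeta_from \<alpha> k l x)"
      by (simp add: zeta_from_def clinear_sum[OF clinear_sigma] complex_vector.scale_sum_right)
  qed
  finally show ?thesis .
qed

section \<open>Linearity, weights and commutation of the path sums\<close>

lemma clinear_sigma_seq: "clinear (sigma_seq J)"
  by (induction J rule: sigma_seq.induct)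
    (auto simp: o_def id_def intro!: clinear_id clinear_compose[OF clinear_sigma])

lemma clinear_zeta: "clinear (zeta lam k)"
  unfolding zeta_def by (intro clinear_setsum clinear_scale clinear_sigma_seq)

text \<open>Along a path every intermediate column gains one box and loses one, so the net effect is
  a single move from \<open>j\<close> to \<open>k\<close>. The function \<open>a\<close> enters only
  through the scalar coefficients.\<close>

lemma zeta_from_weight_space:
  assumes "0 < k" "k \<le> j" "x \<in> weight_space \<alpha>"
  shows "zeta_from a k j x \<in> weight_space (\<lambda>l. \<alpha> l - of_bool (l = j) + of_bool (l = k))"
  using assms(2)
proof (induction j rule: less_induct)
  case (less j)
  show ?case
  proof (cases "j = k")
    case True
    then show ?thesis
      using assms by (simp add: zeta_from_self)
  next
    case False
    have "sigma j l (zeta_from a k l x) \<in>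
        weight_space (\<lambda>l. \<alpha> l - of_bool (l = j) + of_bool (l = k))" if "l \<in> {k..<j}" for l
    proof -
      have "zeta_from a k l x \<in> weight_space (\<lambda>i. \<alpha> i - of_bool (i = l) + of_bool (i = k))"
        using less.IH[of l] that by simp
      from sigma_weight_space[OF this, of j l] show ?thesis
        by (rule back_subst[of "\<lambda>\<alpha>. _ \<in> weight_space \<alpha>"]) auto
    qed
    then show ?thesis
      using False less.prems
      by (auto simp: zeta_from_rec intro!: weight_space_sum weight_space_scale)
  qed
qed

text \<open>
  Only \<open>j = i + 1\<close> leaves a defect. In the recursion for larger \<open>j\<close>, the defect of the summand
  \<open>l = i + 1\<close> cancels against the commutator of \<open>sigma j i\<close> with \<open>sigma i (i + 1)\<close>.
\<close>

lemma zeta_from_sigma: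
  assumes k: "0 < k" and x: "x \<in> weight_space \<beta>"
    and \<beta>: "\<beta> i = int (\<alpha> i) + 1" "\<beta> (i + 1) = int (\<alpha> (i + 1)) - 1"
    and nonzero: "\<And>l. k \<le> l \<Longrightarrow> hook \<alpha> k l \<noteq> 0"
  shows "zeta_from \<alpha> k j (sigma i (i + 1) x) = sigma i (i + 1) (zeta_from \<alpha> k j x)
    + (if j = i + 1 \<and> k \<le> i then (of_int (hook \<alpha> k (i + 1)) / of_int (hook \<alpha> k i)) *\<^sub>C
        zeta_from \<alpha> k i x else 0)"
proof (induction j rule: less_induct)
  case (less j)
  define c :: "nat \<Rightarrow> complex" where "c l = 1 / of_int (hook \<alpha> k l)" for l
  have c: "c l \<noteq> 0" if "k \<le> l" for l
    using nonzero[OF that] by (simp add: c_def)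
  let ?f = "sigma i (i + 1)" and ?z = "\<lambda>l. zeta_from \<alpha> k l x"
  \<comment> \<open>The defect at \<open>j = i + 1\<close>, written so that \<open>c (i + 1)\<close>
    times it is \<open>c i *\<^sub>C ?z i\<close>; this causes the cancellation for larger
    \<open>j\<close>.\<close>
  define e where "e = (c i / c (i + 1)) *\<^sub>C ?z i"
  have e: "(of_int (hook \<alpha> k (i + 1)) / of_int (hook \<alpha> k i)) *\<^sub>C ?z i = e"
    by (simp add: e_def c_def)
  consider "j < k" | "j = k" | "k < j"
    by linarith
  then show ?case
  proof cases
    case 3
    define \<delta> where "\<delta> l = (if l = i + 1 \<and> k \<le> i then e else 0)" for l
    have IH: "zeta_from \<alpha> k l (?f x) = ?f (?z l) + \<delta> l" if "l < j" for l
      using less.IH[OF that] by (simp only: \<delta>_def e)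
    have "zeta_from \<alpha> k j (?f x) = (\<Sum>l\<in>{k..<j}. c l *\<^sub>C sigma j l (?f (?z l) + \<delta> l))"
      unfolding zeta_from_rec[OF 3] c_def by (rule sum.cong[OF refl]) (simp only: IH atLeastLessThan_iff)
    \<comment> \<open>Move \<open>?f\<close> to the front. The commutator of
      \<open>sigma j l\<close> with \<open>sigma i (i + 1)\<close> leaves at most two terms, one if
      \<open>j = i + 1\<close> and one if \<open>l = i\<close>.\<close>
    also have "\<dots> = (\<Sum>l\<in>{k..<j}. c l *\<^sub>C ?f (sigma j l (?z l))
        + c l *\<^sub>C ((if j = i + 1 then sigma i l (?z l) else 0)
          - (if l = i then sigma j (i + 1) (?z l) else 0) + sigma j l (\<delta> l)))"
    proof (rule sum.cong[OF refl])
      fix l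
      have "sigma j l (?f (?z l) + \<delta> l) = ?f (sigma j l (?z l))
          + ((if j = i + 1 then sigma i l (?z l) else 0)
            - (if l = i then sigma j (i + 1) (?z l) else 0) + sigma j l (\<delta> l))"
        by (simp only: clinear_add[OF clinear_sigma] sigma_commutator[of j l i "i + 1"]
            eq_commute[of j "i + 1"] add.assoc add_diff_eq diff_add_eq)
      then show "c l *\<^sub>C sigma j l (?f (?z l) + \<delta> l) = c l *\<^sub>C ?f (sigma j l (?z l))
          + c l *\<^sub>C ((if j = i + 1 then sigma i l (?z l) else 0)
            - (if l = i then sigma j (i + 1) (?z l) else 0) + sigma j l (\<delta> l))"
        by (simp only: scaleC_add_right[symmetric])
    qed
    also have "\<dots> = ?f (?z j) + (\<Sum>l\<in>{k..<j}. c l *\<^sub>C ((if j = i + 1 then sigma i l (?z l) else 0)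
          - (if l = i then sigma j (i + 1) (?z l) else 0) + sigma j l (\<delta> l)))"
      by (simp add: zeta_from_rec[OF 3] c_def sum.distrib clinear_sum[OF clinear_sigma]
          clinear_scaleC[OF clinear_sigma])
    also have "(\<Sum>l\<in>{k..<j}. c l *\<^sub>C ((if j = i + 1 then sigma i l (?z l) else 0)
          - (if l = i then sigma j (i + 1) (?z l) else 0) + sigma j l (\<delta> l))) = \<delta> j"
    proof -
      \<comment> \<open>For \<open>j\<close> at most \<open>i\<close> every error term vanishes. At
        \<open>j = i + 1\<close> the defect arises, and beyond that it cancels; if also
        \<open>i < k\<close>, neither source of error occurs in the range of
        \<open>l\<close>.\<close>
      consider "j \<le> i" | "j = i + 1" | "i + 1 < j" "k \<le> i" | "i + 1 < j" "i < k"
        by linarith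
      then show ?thesis
      proof cases
        case 1
        then show ?thesis
          by (intro trans[OF sum.neutral]) (auto simp: \<delta>_def clinear_zero[OF clinear_sigma])
      next
        case 2
        then have "k \<le> i"
          using 3 by simp
        \<comment> \<open>The weight of \<open>?z i\<close>. The entries at \<open>i\<close> and
          \<open>i + 1\<close> turn the two diagonal operators of the summand \<open>l = i\<close>
          into scalars.\<close>
        define \<gamma> where "\<gamma> p = \<beta> p - of_bool (p = i) + of_bool (p = k)" for p
        have \<gamma>: "\<gamma> i - \<gamma> (i + 1) = int (\<alpha> i) - int (\<alpha> (i + 1)) + 1 + of_bool (i = k)"
          using \<beta> \<open>k \<le> i\<close> by (simp add: \<gamma>_def)
        have "sigma p p (?z i) = of_int (\<gamma> p) *\<^sub>C ?z i" for p
          unfolding \<gamma>_def by (rule sigma_diag[OF zeta_from_weight_space[OF k \<open>k \<le> i\<close> x]])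
        then have w: "sigma i i (?z i) - sigma (i + 1) (i + 1) (?z i) =
            of_int (int (\<alpha> i) - int (\<alpha> (i + 1)) + 1 + of_bool (i = k)) *\<^sub>C ?z i"
          by (simp only: complex_vector.scale_left_diff_distrib[symmetric] of_int_diff[symmetric] \<gamma>)
        have "(\<Sum>l\<in>{k..<j}. c l *\<^sub>C ((if j = i + 1 then sigma i l (?z l) else 0)
            - (if l = i then sigma j (i + 1) (?z l) else 0) + sigma j l (\<delta> l))) =
          (\<Sum>l\<in>{k..<i}. c l *\<^sub>C sigma i l (?z l)) +
          c i *\<^sub>C (sigma i i (?z i) - sigma (i + 1) (i + 1) (?z i))"
          using 2 \<open>k \<le> i\<close> by (simp add: \<delta>_def clinear_zero[OF clinear_sigma])
        also have "\<dots> = e"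
        proof (cases "k = i")
          case True
          \<comment> \<open>The sum over \<open>l < i\<close> is empty and \<open>c i\<close> is 1.
            The box gained by column \<open>k = i\<close> raises the weight difference to exactly
            \<open>hook \<alpha> k (i + 1)\<close>.\<close>
          then show ?thesis
            unfolding w by (simp add: e_def c_def hook_def)
        next
          case False
          with \<open>k \<le> i\<close> have "k < i"
            by simp
          have sum: "(\<Sum>l\<in>{k..<i}. c l *\<^sub>C sigma i l (?z l)) = ?z i"
            by (simp add: zeta_from_rec[OF \<open>k < i\<close>] c_def)
          \<comment> \<open>Consecutive hooks differ by the weight difference. So the 1 from the
            recursion for \<open>?z i\<close> and the diagonal term add up to the ratio in
            \<open>e\<close>; this is what determines the denominators.\<close>
          have ratio: "c i / c (i + 1) = 1 + c i * of_int (int (\<alpha> i) - int (\<alpha> (i + 1)) + 1)"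
          proof -
            let ?d = "int (\<alpha> i) - int (\<alpha> (i + 1)) + 1"
            have "hook \<alpha> k (i + 1) = hook \<alpha> k i + ?d"
              using \<open>k < i\<close> by (simp add: hook_def)
            then have "c i / c (i + 1) = (of_int (hook \<alpha> k i) + of_int ?d) / of_int (hook \<alpha> k i)"
              by (simp add: c_def del: of_int_diff)
            then show ?thesis
              using nonzero[of i] \<open>k < i\<close> by (simp add: c_def add_divide_distrib)
          qed
          show ?thesis
            unfolding w e_def ratio sum using False
            by (simp add: scaleC_add_left del: of_int_add of_int_diff)
        qed
        finally show ?thesis
          using 2 \<open>k \<le> i\<close> by (simp add: \<delta>_def)
      next
        case 3
        then have "{k..<j} = insert i (insert (i + 1) ({k..<j} - {i, i + 1}))"
          by auto
        then have "(\<Sum>l\<in>{k..<j}. c l *\<^sub>C ((if j = i + 1 then sigma i l (?z l) else 0)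
            - (if l = i then sigma j (i + 1) (?z l) else 0) + sigma j l (\<delta> l))) =
          (\<Sum>l\<in>{i, i + 1}. c l *\<^sub>C ((if j = i + 1 then sigma i l (?z l) else 0)
            - (if l = i then sigma j (i + 1) (?z l) else 0) + sigma j l (\<delta> l)))"
          using 3 by (intro sum.mono_neutral_right) (auto simp: \<delta>_def clinear_zero[OF clinear_sigma])
        \<comment> \<open>The commutator at \<open>l = i\<close> gives
          \<open>- c i *\<^sub>C sigma j (i + 1) (?z i)\<close>, and the inherited defect at
          \<open>l = i + 1\<close> gives its negative.\<close>
        also have "\<dots> = 0"
          using 3 c[of "i + 1"]
          by (simp add: \<delta>_def e_def clinear_zero[OF clinear_sigma] clinear_scaleC[OF clinear_sigma])
        finally show ?thesis
          using 3 by (simp add: \<delta>_def)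
      next
        case 4
        then show ?thesis
          by (intro trans[OF sum.neutral]) (auto simp: \<delta>_def clinear_zero[OF clinear_sigma])
      qed
    qed
    finally show ?thesis
      by (simp only: \<delta>_def e)
  \<comment> \<open>Below \<open>k\<close> both path sums vanish, and at \<open>k\<close> they are
    the identity. The defect condition \<open>j = i + 1\<close> with \<open>k \<le> i\<close> would
    force \<open>k < j\<close>.\<close>
  qed (use k in \<open>auto simp: zeta_from_below zeta_from_self clinear_zero[OF clinear_sigma]\<close>)
qed

section \<open>Appending a box\<close>

lemma finite_diagram_col: "finite {r. (r, i) \<in> diagram lam}"
  by (rule finite_subset[of _ "{..length lam}"]) (auto simp: diagram_def)

text \<open>Rows are left-justified, so each row that meets column \<open>j\<close> also meets
  column \<open>i\<close>.\<close>

lemma conj_part_antimono: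
  assumes "1 \<le> i" "i \<le> j"
  shows "conj_part lam j \<le> conj_part lam i"
  unfolding conj_part_def
  by (rule card_mono[OF finite_diagram_col]) (use assms in \<open>auto simp: diagram_def\<close>)

lemma diagram_col_le:
  assumes "is_partition lam" "(r, c) \<in> diagram lam"
  shows "c \<le> num_cols lam"
proof -
  from assms(2) have r: "r - 1 < length lam" "c \<le> lam ! (r - 1)"
    by (auto simp: diagram_def)
  have "lam ! (r - 1) \<le> lam ! 0"
    using assms(1) r(1) sorted_wrt_nth_less[of "(\<ge>)" lam 0 "r - 1"]
    by (cases "r - 1 = 0") (auto simp: is_partition_def)
  then show ?thesis
    using r by (cases lam) (auto simp: num_cols_def)
qed

lemma conj_part_beyond: "is_partition lam \<Longrightarrow> num_cols lam < i \<Longrightarrow> conj_part lam i = 0"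
  using diagram_col_le[of lam _ i] by (force simp: conj_part_def card_eq_0_iff)

lemma appends_box_conj_part:
  assumes "appends_box lam mu k"
  shows "conj_part mu = (conj_part lam)(k := conj_part lam k + 1)"
proof
  fix i
  obtain r where r: "(r, k) \<notin> diagram lam" "diagram mu = insert (r, k) (diagram lam)"
    using assms by (auto simp: appends_box_def)
  have "{r'. (r', i) \<in> diagram mu} =
      (if i = k then insert r {r'. (r', i) \<in> diagram lam} else {r'. (r', i) \<in> diagram lam})"
    by (auto simp: r)
  then show "conj_part mu i = ((conj_part lam)(k := conj_part lam k + 1)) i"
    using r(1) by (simp add: conj_part_def finite_diagram_col)
qed

lemma appends_box_pos: "appends_box lam mu k \<Longrightarrow> 0 < k"
proof -
  assume "appends_box lam mu k"
  then obtain r where "diagram mu = insert (r, k) (diagram lam)"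
    by (auto simp: appends_box_def)
  then have "(r, k) \<in> diagram mu"
    by simp
  then show "0 < k"
    by (simp add: diagram_def)
qed

lemma appends_box_le:
  assumes "is_partition lam" "appends_box lam mu k"
  shows "k \<le> num_cols lam + 1"
proof (rule ccontr)
  assume k: "\<not> k \<le> num_cols lam + 1"
  obtain r where r: "diagram mu = insert (r, k) (diagram lam)"
    using assms(2) by (auto simp: appends_box_def)
  then have "(r, k) \<in> diagram mu"
    by simp
  \<comment> \<open>The left neighbour of the new box is an old box, yet it would lie beyond the
    last column of \<open>lam\<close>.\<close>
  then have "(r, k - 1) \<in> diagram mu"
    using k by (auto simp: diagram_def)
  then have "(r, k - 1) \<in> diagram lam"
    using r k by auto
  then show False
    using diagram_col_le[OF assms(1)] k by fastforce
qed

section \<open>Placing a vector and then applying \<open>zeta\<close>\<close>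

lemma clinear_place: "clinear (place lam v)"
  unfolding place_def by (rule clinear_wedge_right)

lemma clinear_place_left: "clinear (\<lambda>v. place lam v x)"
proof (rule clinearI)
  have "in_copy j (c *\<^sub>C v) = c *\<^sub>C in_copy j v" for j c and v :: 'a
    by (simp add: poly_mapping_eq_iff fun_eq_iff lookup_single when_def)
  then show "place lam (c *\<^sub>C v) x = c *\<^sub>C place lam v x" for c v
    by (simp add: place_def wedge_right_scale)
qed (simp add: place_def single_add wedge_right_add)

lemma place_weight_space:
  "x \<in> weight_space \<alpha> \<Longrightarrow>
     place lam v x \<in> weight_space (\<lambda>l. \<alpha> l + of_bool (l = num_cols lam + 1))"
  unfolding place_def by (rule wedge_right_weight_space)

text \<open>\<open>place\<close> adds a box to the column after the last one, and
  \<open>zeta\<close> carries it to column \<open>k\<close>. The weight is arbitrary because the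
  lemma serves both for the columns of \<open>lam\<close> and for the shifted weights in
  \<open>Imod\<close>.\<close>

lemma zeta_place_weight_space:
  assumes "is_partition lam" "appends_box lam mu k" "x \<in> weight_space \<alpha>"
  shows "zeta lam k (place lam v x) \<in> weight_space (\<lambda>l. \<alpha> l + of_bool (l = k))"
  using zeta_from_weight_space[OF appends_box_pos[OF assms(2)] appends_box_le[OF assms(1,2)]
      place_weight_space[OF assms(3), where lam = lam and v = v], where a = "conj_part lam"]
  by (simp add: zeta_def zeta_from_def)

lemma zeta_place_Xmod:
  assumes "is_partition lam" "appends_box lam mu k" "x \<in> Xmod (conj_part lam)"
  shows "zeta lam k (place lam v x) \<in> Xmod (conj_part mu)"
  using zeta_place_weight_space[OF assms(1,2) assms(3)[unfolded Xmod_eq_weight_space], of v]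
  unfolding Xmod_eq_weight_space
  by (rule back_subst[of "\<lambda>\<alpha>. _ \<in> weight_space \<alpha>"])
    (auto simp: appends_box_conj_part[OF assms(2)])

lemma zeta_place_sigma:
  assumes lam: "is_partition lam" and box: "appends_box lam mu k"
    and i: "1 \<le> i" "conj_part lam (i + 1) > 0"
    and x: "x \<in> Xmod ((conj_part lam)
       (i := conj_part lam i + 1, i + 1 := conj_part lam (i + 1) - 1))"
  shows "zeta lam k (place lam v (sigma i (i + 1) x)) = sigma i (i + 1) (zeta lam k (place lam v x))"
proof -
  let ?m = "num_cols lam + 1" and ?a = "conj_part lam"
  \<comment> \<open>Column \<open>i + 1\<close> is nonempty, so it lies strictly before the column
    of the placed vector. This excludes the defect, and \<open>sigma i (i + 1)\<close> kills the
    placed vector.\<close>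
  have m: "i + 1 < ?m"
    using conj_part_beyond[OF lam, of "i + 1"] i by fastforce
  \<comment> \<open>Columns do not grow to the right, so each hook is at least 1 and no denominator
    vanishes.\<close>
  have hook: "hook ?a k l \<noteq> 0" if "k \<le> l" for l
    using conj_part_antimono[of k l lam] appends_box_pos[OF box] that by (simp add: hook_def)
  have zeta: "zeta lam k = zeta_from ?a k ?m"
    by (simp add: zeta_def zeta_from_def fun_eq_iff)
  have "place lam v (sigma i (i + 1) x) = sigma i (i + 1) (place lam v x)"
    using m by (simp add: place_def sigma_wedge_right lookup_single wedge_right_zero)
  then show ?thesis
    using zeta_from_sigma[OF appends_box_pos[OF box]
        place_weight_space[OF x[unfolded Xmod_eq_weight_space], where lam = lam and v = v], of i ?a ?m] m i hook
    by (simp add: zeta of_nat_diff)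
qed

lemma zeta_place_Imod:
  assumes lam: "is_partition lam" and box: "appends_box lam mu k" and x: "x \<in> Imod lam"
  shows "zeta lam k (place lam v x) \<in> Imod mu"
  unfolding Imod_def
proof (rule clinear_image_span[OF clinear_compose[OF clinear_zeta clinear_place] _ x[unfolded Imod_def]])
  let ?a = "conj_part lam" and ?b = "conj_part mu"
  fix y :: "'a cols"
  assume "y \<in> (\<Union>i\<in>{i. 1 \<le> i \<and> ?a (i + 1) > 0}.
    sigma i (i + 1) ` Xmod (?a(i := ?a i + 1, i + 1 := ?a (i + 1) - 1)))"
  then obtain i z where i: "1 \<le> i" "?a (i + 1) > 0"
    and z: "z \<in> Xmod (?a(i := ?a i + 1, i + 1 := ?a (i + 1) - 1))" and y: "y = sigma i (i + 1) z"
    by blast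
  let ?z = "zeta lam k (place lam v z)"
  \<comment> \<open>The box added in column \<open>k\<close> is independent of the shift between
    columns \<open>i\<close> and \<open>i + 1\<close>; positivity of column \<open>i + 1\<close>
    makes the natural subtraction exact.\<close>
  have "?z \<in> Xmod (?b(i := ?b i + 1, i + 1 := ?b (i + 1) - 1))"
    using zeta_place_weight_space[OF lam box z[unfolded Xmod_eq_weight_space], of v]
    unfolding Xmod_eq_weight_space
    by (rule back_subst[of "\<lambda>\<alpha>. _ \<in> weight_space \<alpha>"])
      (use i in \<open>auto simp: appends_box_conj_part[OF box] fun_eq_iff\<close>)
  moreover have "?b (i + 1) > 0"
    using i by (simp add: appends_box_conj_part[OF box])
  ultimately show "zeta lam k (place lam v y) \<in> cspan (\<Union>i\<in>{i. 1 \<le> i \<and> ?b (i + 1) > 0}.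
      sigma i (i + 1) ` Xmod (?b(i := ?b i + 1, i + 1 := ?b (i + 1) - 1)))"
    unfolding y zeta_place_sigma[OF lam box i z]
    using i(1) by (intro complex_vector.span_base) blast
qed


section \<open>Maps out of a tensor product with a quotient\<close>

lemma mem_coset_iff: "y \<in> coset I x \<longleftrightarrow> y - x \<in> I"
proof
  assume "y - x \<in> I"
  then have "x + (y - x) \<in> coset I x"
    unfolding coset_def by (rule imageI)
  then show "y \<in> coset I x"
    by simp
qed (auto simp: coset_def)

lemma coset_eq_iff:
  assumes "complex_vector.subspace I"
  shows "coset I x = coset I y \<longleftrightarrow> x - y \<in> I"
proof
  assume "coset I x = coset I y"
  then show "x - y \<in> I"
    using mem_coset_iff[of x I x] mem_coset_iff[of x I y] complex_vector.subspace_0[OF assms] by simp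
next
  assume xy: "x - y \<in> I"
  have "z - x \<in> I \<longleftrightarrow> z - y \<in> I" for z
    using complex_vector.subspace_add[OF assms _ xy, of "z - x"]
      complex_vector.subspace_diff[OF assms _ xy, of "z - y"] by auto
  then show "coset I x = coset I y"
    by (auto simp: mem_coset_iff)
qed

lemma quot_linear_add:
  assumes "quot_linear X I Y J \<phi>" "x \<in> X" "x' \<in> X" "y \<in> \<phi> (coset I x)" "y' \<in> \<phi> (coset I x')"
  shows "\<phi> (coset I (x + x')) = coset J (y + y')"
  using assms unfolding quot_linear_def by blast

lemma quot_linear_scale:
  assumes "quot_linear X I Y J \<phi>" "x \<in> X" "y \<in> \<phi> (coset I x)"
  shows "\<phi> (coset I (c *\<^sub>C x)) = coset J (c *\<^sub>C y)"
  using assms unfolding quot_linear_def by blast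

lemma quot_linear_unique:
  assumes J: "complex_vector.subspace J"
    and X: "X = cspan S"
    and \<phi>: "quot_linear X I Y J \<phi>" and \<psi>: "quot_linear X I Y J \<psi>"
    and eq: "\<And>x. x \<in> S \<Longrightarrow> \<phi> (coset I x) = \<psi> (coset I x)"
    and x: "x \<in> X"
  shows "\<phi> (coset I x) = \<psi> (coset I x)"
proof -
  \<comment> \<open>Linearity in \<open>quot_linear\<close> is phrased through elements of the
    values, so it can be applied only once these are known to be nonempty cosets.\<close>
  have ex: "\<exists>y. y \<in> \<chi> (coset I x)" if "quot_linear X I Y J \<chi>" "x \<in> X" for \<chi> x
  proof -
    have "\<chi> (coset I x) \<in> quot Y J"
      using that by (auto simp: quot_linear_def quot_def)
    then obtain y where "\<chi> (coset I x) = coset J y"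
      by (auto simp: quot_def)
    then show ?thesis
      using complex_vector.subspace_0[OF J] by (auto simp: mem_coset_iff intro!: exI[of _ y])
  qed
  have add: "\<phi> (coset I (x + y)) = \<psi> (coset I (x + y))"
    if xy: "x \<in> X" "y \<in> X" and eq: "\<phi> (coset I x) = \<psi> (coset I x)" "\<phi> (coset I y) = \<psi> (coset I y)"
    for x y
  proof -
    obtain x' y' where "x' \<in> \<phi> (coset I x)" "y' \<in> \<phi> (coset I y)"
      using ex[OF \<phi>] xy by blast
    then show ?thesis
      using quot_linear_add[OF \<phi> xy] quot_linear_add[OF \<psi> xy] by (simp add: eq)
  qed
  have scale: "\<phi> (coset I (c *\<^sub>C x)) = \<psi> (coset I (c *\<^sub>C x))"
    if x: "x \<in> X" and eq: "\<phi> (coset I x) = \<psi> (coset I x)" for c x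
  proof -
    obtain y where "y \<in> \<phi> (coset I x)"
      using ex[OF \<phi>] x by blast
    then show ?thesis
      using quot_linear_scale[OF \<phi> x] quot_linear_scale[OF \<psi> x] by (simp add: eq)
  qed
  \<comment> \<open>Membership in \<open>X\<close> is carried along, since additivity is available
    only for summands in \<open>X\<close>.\<close>
  have "x \<in> X \<and> \<phi> (coset I x) = \<psi> (coset I x)"
    using x[unfolded X]
  proof (induction x rule: complex_vector.span_induct_alt)
    case base
    have zero: "0 \<in> X"
      unfolding X by (rule complex_vector.span_zero)
    obtain y y' where "y \<in> \<phi> (coset I 0)" "y' \<in> \<psi> (coset I 0)"
      using ex[OF \<phi> zero] ex[OF \<psi> zero] by blast
    then have "\<phi> (coset I (0 *\<^sub>C 0)) = coset J (0 *\<^sub>C y)" "\<psi> (coset I (0 *\<^sub>C 0)) = coset J (0 *\<^sub>C y')"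
      using quot_linear_scale[OF \<phi> zero] quot_linear_scale[OF \<psi> zero] by blast+
    then show ?case
      using zero by simp
  next
    case (step c b y)
    then have b: "b \<in> X"
      unfolding X by (intro complex_vector.span_base)
    have cb: "c *\<^sub>C b \<in> X"
      using b unfolding X by (rule complex_vector.span_scale)
    then have "c *\<^sub>C b + y \<in> X"
      using step.IH unfolding X by (blast intro: complex_vector.span_add)
    then show ?case
      using add[OF cb _ scale[OF b eq[OF step.hyps]]] step.IH by blast
  qed
  then show ?thesis ..
qed

text \<open>Universal property of the tensor product, passed to quotients. Existence comes from
  extending \<open>B\<close> freely on pairs and checking the relations, uniqueness from the
  spanning pure tensors.\<close>

lemma ex1_induced_map:
  fixes B :: "'v::complex_vector \<Rightarrow> 'e::complex_vector \<Rightarrow> 'f::complex_vector"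
  assumes X: "complex_vector.subspace X" and I: "complex_vector.subspace I"
    and Y: "complex_vector.subspace Y" and J: "complex_vector.subspace J"
    and left: "\<And>x. clinear (\<lambda>v. B v x)" and right: "\<And>v. clinear (B v)"
    and XY: "\<And>v x. x \<in> X \<Longrightarrow> B v x \<in> Y" and IJ: "\<And>v x. x \<in> I \<Longrightarrow> B v x \<in> J"
  shows "\<exists>!\<phi>. \<phi> \<in> V_tensor_quot X I \<rightarrow>\<^sub>E quot Y J \<and>
    quot_linear (tensor_free X I) (tensor_rels X I) Y J \<phi> \<and>
    (\<forall>v. \<forall>x\<in>X. \<phi> (pure_tensor X I v (coset I x)) = coset J (B v x))"
proof (rule ex_ex1I)
  let ?F = "tensor_free X I :: ('v \<times> 'e set \<Rightarrow>\<^sub>0 complex) set"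
  let ?R = "tensor_rels X I :: ('v \<times> 'e set \<Rightarrow>\<^sub>0 complex) set"
  have R: "complex_vector.subspace ?R"
    unfolding tensor_rels_def by (rule complex_vector.subspace_span)
  define rep where "rep A = (SOME x. x \<in> X \<and> coset I x = A)" for A
  have rep: "rep A \<in> X \<and> coset I (rep A) = A" if "A \<in> quot X I" for A
    unfolding rep_def by (rule someI_ex) (use that in \<open>auto simp: quot_def\<close>)
  define \<Phi> where "\<Phi> = free_lin (\<lambda>(v :: 'v, A). B v (rep A))"
  have lin: "clinear \<Phi>"
    unfolding \<Phi>_def by (rule clinear_free_lin)
  have \<Phi>_basis: "\<Phi> (basis_elt (v, A)) = B v (rep A)" for v A
    by (simp add: \<Phi>_def)
  \<comment> \<open>The chosen representative may differ from \<open>x\<close> by an element of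
    \<open>I\<close>, which \<open>B v\<close> sends into \<open>J\<close>; modulo \<open>J\<close>
    the choice is immaterial.\<close>
  have \<Phi>_coset: "\<Phi> (basis_elt (v, coset I x)) - B v x \<in> J" if "x \<in> X" for v x
  proof -
    have "coset I (rep (coset I x)) = coset I x"
      using rep that by (auto simp: quot_def)
    then have "B v (rep (coset I x) - x) \<in> J"
      by (intro IJ) (simp add: coset_eq_iff[OF I])
    then show ?thesis
      by (simp add: \<Phi>_basis clinear_diff[OF right])
  qed
  have \<Phi>_free: "\<Phi> t \<in> Y" if "t \<in> ?F" for t
  proof -
    have "\<Phi> t \<in> cspan Y"
      using that unfolding tensor_free_def
      by (rule clinear_image_span[OF lin, rotated])
        (use rep XY in \<open>auto simp: \<Phi>_basis intro: complex_vector.span_base\<close>)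
    then show ?thesis
      by (simp add: complex_vector.span_eq_iff[THEN iffD2, OF Y])
  qed
  \<comment> \<open>Relations in the vector argument go to 0, as the representative is the same
    throughout. Relations in the coset argument hold only modulo \<open>J\<close>, because
    representatives need not add up.\<close>
  have \<Phi>_rels: "\<Phi> t \<in> J" if "t \<in> ?R" for t
  proof -
    have add: "\<Phi> (basis_elt (v, coset I (x + y)) - basis_elt (v, coset I x) - basis_elt (v, coset I y)) \<in> J"
      if "x \<in> X" "y \<in> X" for v x y
    proof -
      let ?d = "\<lambda>x. \<Phi> (basis_elt (v, coset I x)) - B v x"
      have "?d (x + y) - ?d x - ?d y \<in> J"
        using that by (intro complex_vector.subspace_diff[OF J] \<Phi>_coset complex_vector.subspace_add[OF X])
      then show ?thesis
        by (simp add: clinear_diff[OF lin] clinear_add[OF lin] clinear_add[OF right] algebra_simps)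
    qed
    have scale: "\<Phi> (basis_elt (v, coset I (c *\<^sub>C x)) - c *\<^sub>C basis_elt (v, coset I x)) \<in> J"
      if "x \<in> X" for v c x
    proof -
      let ?d = "\<lambda>x. \<Phi> (basis_elt (v, coset I x)) - B v x"
      have "?d (c *\<^sub>C x) - c *\<^sub>C ?d x \<in> J"
        using that by (intro complex_vector.subspace_diff[OF J] complex_vector.subspace_scale[OF J]
            \<Phi>_coset complex_vector.subspace_scale[OF X])
      then show ?thesis
        by (simp add: clinear_diff[OF lin] clinear_scaleC[OF lin] clinear_scaleC[OF right]
            complex_vector.scale_right_diff_distrib)
    qed
    have "\<Phi> t \<in> cspan J"
      using that unfolding tensor_rels_def
    proof (rule clinear_image_span[OF lin, rotated])
      fix r :: "'v \<times> 'e set \<Rightarrow>\<^sub>0 complex"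
      assume "r \<in> {basis_elt (v + w, A) - basis_elt (v, A) - basis_elt (w, A) | v w A. A \<in> quot X I} \<union>
        {basis_elt (c *\<^sub>C v, A) - c *\<^sub>C basis_elt (v, A) | c v A. A \<in> quot X I} \<union>
        {basis_elt (v, coset I (x + y)) - basis_elt (v, coset I x) - basis_elt (v, coset I y)
           | v x y. x \<in> X \<and> y \<in> X} \<union>
        {basis_elt (v, coset I (c *\<^sub>C x)) - c *\<^sub>C basis_elt (v, coset I x) | v c x. x \<in> X}"
      then have "\<Phi> r \<in> J"
        using add scale complex_vector.subspace_0[OF J]
        by (auto simp: clinear_diff[OF lin] clinear_scaleC[OF lin] \<Phi>_basis clinear_add[OF left]
            clinear_scaleC[OF left])
      then show "\<Phi> r \<in> cspan J"
        by (rule complex_vector.span_base)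
    qed
    then show ?thesis
      by (simp add: complex_vector.span_eq_iff[THEN iffD2, OF J])
  qed
  \<comment> \<open>All cosets in the union coincide, so their union is the common value and no
    element of \<open>T\<close> has to be chosen. The restriction makes the map extensional.\<close>
  define \<phi> where "\<phi> = restrict (\<lambda>T. \<Union>t\<in>T. coset J (\<Phi> t)) (V_tensor_quot X I)"
  have \<phi>: "\<phi> (coset ?R t) = coset J (\<Phi> t)" if "t \<in> ?F" for t
  proof -
    have "coset J (\<Phi> s) = coset J (\<Phi> t)" if "s \<in> coset ?R t" for s
      using that \<Phi>_rels by (simp add: mem_coset_iff coset_eq_iff[OF J] clinear_diff[OF lin, symmetric])
    moreover have "t \<in> coset ?R t"
      by (simp add: mem_coset_iff complex_vector.subspace_0[OF R])
    ultimately have "(\<Union>s\<in>coset ?R t. coset J (\<Phi> s)) = coset J (\<Phi> t)"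
      by (intro SUP_eq_const) blast+
    then show ?thesis
      using that by (simp add: \<phi>_def V_tensor_quot_def quot_def)
  qed
  have basis_free: "basis_elt (v, coset I x) \<in> ?F" if "x \<in> X" for v x
    unfolding tensor_free_def
    by (rule complex_vector.span_base) (use that in \<open>auto simp: quot_def\<close>)
  have F: "complex_vector.subspace ?F"
    unfolding tensor_free_def by (rule complex_vector.subspace_span)
  have "\<phi> \<in> V_tensor_quot X I \<rightarrow>\<^sub>E quot Y J"
  proof
    fix T :: "('v \<times> 'e set \<Rightarrow>\<^sub>0 complex) set"
    assume "T \<in> V_tensor_quot X I"
    then show "\<phi> T \<in> quot Y J"
      using \<phi> \<Phi>_free by (auto simp: V_tensor_quot_def quot_def)
  qed (simp add: \<phi>_def)
  moreover have "quot_linear ?F ?R Y J \<phi>"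
    unfolding quot_linear_def
  proof (intro conjI ballI allI)
    show "\<phi> \<in> quot ?F ?R \<rightarrow> quot Y J"
      using \<phi> \<Phi>_free by (auto simp: quot_def)
  next
    fix t t' y y'
    assume t: "t \<in> ?F" "t' \<in> ?F" and y: "y \<in> \<phi> (coset ?R t)" "y' \<in> \<phi> (coset ?R t')"
    have "(y - \<Phi> t) + (y' - \<Phi> t') \<in> J"
      using t y by (intro complex_vector.subspace_add[OF J]) (simp_all add: \<phi> mem_coset_iff)
    then have "coset J (y + y') = coset J (\<Phi> t + \<Phi> t')"
      by (simp add: coset_eq_iff[OF J] algebra_simps)
    then show "\<phi> (coset ?R (t + t')) = coset J (y + y')"
      using t by (simp add: \<phi> complex_vector.subspace_add[OF F] clinear_add[OF lin])
  next
    fix c t y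
    assume t: "t \<in> ?F" and y: "y \<in> \<phi> (coset ?R t)"
    have "c *\<^sub>C (y - \<Phi> t) \<in> J"
      using t y by (intro complex_vector.subspace_scale[OF J]) (simp add: \<phi> mem_coset_iff)
    then have "coset J (c *\<^sub>C y) = coset J (c *\<^sub>C \<Phi> t)"
      by (simp add: coset_eq_iff[OF J] complex_vector.scale_right_diff_distrib)
    then show "\<phi> (coset ?R (c *\<^sub>C t)) = coset J (c *\<^sub>C y)"
      using t by (simp add: \<phi> complex_vector.subspace_scale[OF F] clinear_scaleC[OF lin])
  qed
  moreover have "\<forall>v. \<forall>x\<in>X. \<phi> (pure_tensor X I v (coset I x)) = coset J (B v x)"
    using \<Phi>_coset by (simp add: pure_tensor_def \<phi> basis_free coset_eq_iff[OF J])
  ultimately show "\<exists>\<phi>. \<phi> \<in> V_tensor_quot X I \<rightarrow>\<^sub>E quot Y J \<and>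
      quot_linear ?F ?R Y J \<phi> \<and>
      (\<forall>v. \<forall>x\<in>X. \<phi> (pure_tensor X I v (coset I x)) = coset J (B v x))"
    by blast
next
  fix \<phi> \<psi> :: "('v \<times> 'e set \<Rightarrow>\<^sub>0 complex) set \<Rightarrow> 'f set"
  assume \<phi>: "\<phi> \<in> V_tensor_quot X I \<rightarrow>\<^sub>E quot Y J \<and>
      quot_linear (tensor_free X I) (tensor_rels X I) Y J \<phi> \<and>
      (\<forall>v. \<forall>x\<in>X. \<phi> (pure_tensor X I v (coset I x)) = coset J (B v x))"
    and \<psi>: "\<psi> \<in> V_tensor_quot X I \<rightarrow>\<^sub>E quot Y J \<and>
      quot_linear (tensor_free X I) (tensor_rels X I) Y J \<psi> \<and>
      (\<forall>v. \<forall>x\<in>X. \<psi> (pure_tensor X I v (coset I x)) = coset J (B v x))"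
  show "\<phi> = \<psi>"
  \<comment> \<open>Extensional maps are compared on their domain only, where cosets of the free
    generators are pure tensors and both values are prescribed.\<close>
  proof (rule PiE_ext[of _ "V_tensor_quot X I" "\<lambda>_. quot Y J"])
    fix T :: "('v \<times> 'e set \<Rightarrow>\<^sub>0 complex) set"
    assume "T \<in> V_tensor_quot X I"
    then obtain t where t: "t \<in> tensor_free X I" "T = coset (tensor_rels X I) t"
      by (auto simp: V_tensor_quot_def quot_def)
    show "\<phi> T = \<psi> T"
      unfolding t(2)
    proof (rule quot_linear_unique[OF J tensor_free_def _ _ _ t(1)])
      fix s :: "'v \<times> 'e set \<Rightarrow>\<^sub>0 complex"
      assume "s \<in> {basis_elt (v, A) | v A. A \<in> quot X I}"
      then obtain v x where "s = basis_elt (v, coset I x)" "x \<in> X"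
        by (auto simp: quot_def)
      then show "\<phi> (coset (tensor_rels X I) s) = \<psi> (coset (tensor_rels X I) s)"
        using \<phi> \<psi> by (simp add: pure_tensor_def)
    qed (use \<phi> \<psi> in blast)+
  qed (use \<phi> \<psi> in blast)+
qed

section \<open>The inclusion of relation spaces and the induced map of Schur modules\<close>

lemma subspace_Imod: "complex_vector.subspace (Imod lam)"
  unfolding Imod_def by (rule complex_vector.subspace_span)

theorem theorem3p5:
  fixes lam mu :: "nat list" and k :: nat
  assumes "\<exists>B. finite_dimensional_vector_space
      (scaleC :: complex \<Rightarrow> 'v \<Rightarrow> 'v::complex_vector) B"
    and "is_partition lam" and "is_partition mu" and "appends_box lam mu k"
  shows "zeta lam k ` V_tensor lam (Imod lam :: 'v cols set) \<subseteq> Imod mu \<and>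
    (\<exists>!\<phi> :: ('v \<times> 'v cols set \<Rightarrow>\<^sub>0 complex) set \<Rightarrow> 'v cols set. induced_by_zeta lam mu k \<phi>)"
proof
  note lam = assms(2) and box = assms(4)
  show "zeta lam k ` V_tensor lam (Imod lam :: 'v cols set) \<subseteq> Imod mu"
  proof (rule image_subsetI)
    fix x :: "'v cols"
    assume "x \<in> V_tensor lam (Imod lam)"
    then have "zeta lam k x \<in> cspan (Imod mu)"
      unfolding V_tensor_def
      by (rule clinear_image_span[OF clinear_zeta, rotated])
        (auto intro: complex_vector.span_base zeta_place_Imod[OF lam box])
    then show "zeta lam k x \<in> Imod mu"
      by (simp add: complex_vector.span_eq_iff[THEN iffD2, OF subspace_Imod])
  qed
  show "\<exists>!\<phi> :: ('v \<times> 'v cols set \<Rightarrow>\<^sub>0 complex) set \<Rightarrow> 'v cols set. induced_by_zeta lam mu k \<phi>"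
    unfolding induced_by_zeta_def Schur_def
  \<comment> \<open>This \<open>B\<close> is bilinear. It maps \<open>Xmod\<close> into
    \<open>Xmod\<close> by weights, and \<open>Imod lam\<close> into \<open>Imod mu\<close> by the
    commutation with \<open>sigma i (i + 1)\<close>.\<close>
  proof (rule ex1_induced_map[where B = "\<lambda>v x. zeta lam k (place lam v x)"])
    show "clinear (\<lambda>v. zeta lam k (place lam v x))" for x :: "'v cols"
      by (rule clinear_compose[OF clinear_zeta clinear_place_left])
    show "clinear (\<lambda>x. zeta lam k (place lam v x))" for v :: 'v
      by (rule clinear_compose[OF clinear_zeta clinear_place])
  qed (use zeta_place_Xmod[OF lam box] zeta_place_Imod[OF lam box] in
      \<open>simp_all add: subspace_Xmod subspace_Imod\<close>)
qed

end
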